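(* Let $\alpha,\beta\in(0,1)$, $\epsilon>0$, and let $(\tau,\hat d)$ be an $\epsilon$-differentially private sequential test of $\theta=\theta_0$ against $\theta=\theta_1$ with $\mathbb{P}_{\theta_0}(\hat d=1)\le\alpha$ and $\mathbb{P}_{\theta_1}(\hat d=0)\le\beta$. Then $$\mathbb{E}_{\theta_0}[\tau]\ge\frac{\mathrm{kl}(\alpha,1-\beta)}{\min\left(\mathrm{KL}(\nu_{\theta_0},\nu_{\theta_1}),\ \epsilon\cdot\mathrm{TV}(\nu_{\theta_0},\nu_{\theta_1})\right)}$$ and $$\mathbb{E}_{\theta_1}[\tau]\ge\frac{\mathrm{kl}(\beta,1-\alpha)}{\min\left(\mathrm{KL}(\nu_{\theta_1},\nu_{\theta_0}),\ \epsilon\cdot\mathrm{TV}(\nu_{\theta_0},\nu_{\theta_1})\right)},$$ where $\mathrm{TV}$ is the total variation distance and $\mathrm{kl}(x,y)=x\log(x/y)+(1-x)\log((1-x)/(1-y))$ is the binary relative entropy.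
   Context: $\nu_{\theta_0}\ne\nu_{\theta_1}$ are two probability distributions (with densities with respect to a common reference measure) on the observation space; under $\mathbb{P}_{\theta}$ (expectation $\mathbb{E}_\theta$) the observations $X_1,X_2,\dots$ are i.i.d. with law $\nu_\theta$. $\mathrm{KL}$ is the Kullback–Leibler divergence. A sequential test is a pair $(\tau,\hat d)$: $\tau$ is a stopping time with respect to the filtration generated by the observations (together with internal randomness of the test, independent of the data), and $\hat d\in\{0,1\}$ is a decision made at time $\tau$, based on the information available at time $\tau$. It is viewed as a randomized mechanism $\mathcal{M}(\underline{X})=(\tau(\underline{X}),\hat d(\underline{X}))$ acting on infinite observation sequences $\underline{X}=(X_1,X_2,\dots)$. Two observation sequences are neighboring if they differ in at most one index. The test is $\epsilon$-differentially private if for all neighboring $\underline{X},\underline{X}'$ and all $(t,d)\in\mathbb{N}\times\{0,1\}$, $\Pr[\mathcal{M}(\underline{X})=(t,d)]\le e^\epsilon\Pr[\mathcal{M}(\underline{X}')=(t,d)]$.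
   Formalization: The formal theorem adds the assumption α+β ≤ 1; without it the bound is false, since for α+β > 1 a test that stops at once and decides by a data-independent coin meets both error bounds while kl(α,1−β) > 0. *)

theory Defs
  imports "HOL-Probability.Probability"
begin

text \<open>Natural logarithms throughout; the privacy parameter \<open>\<epsilon>\<close> fixes this unit.\<close>

definition kl :: "real \<Rightarrow> real \<Rightarrow> real" where
  "kl x y = x * ln (x / y) + (1 - x) * ln ((1 - x) / (1 - y))"

text \<open>
  \<open>KL P Q\<close> is the divergence of \<open>P\<close> from \<open>Q\<close>.  The library constant takes its arguments in the
  opposite order and is real-valued, returning a junk value where the divergence is infinite.
  For probability measures with \<open>P \<lless> Q\<close> the negative part of the log-density is
  \<open>P\<close>-integrable, so non-integrability means that the divergence is \<open>\<infinity>\<close>.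
\<close>

definition KL :: "'a measure \<Rightarrow> 'a measure \<Rightarrow> ennreal" where
  "KL P Q =
     (if absolutely_continuous Q P \<and> integrable P (entropy_density (exp 1) Q P)
      then ennreal (KL_divergence (exp 1) Q P) else \<infinity>)"

definition TV :: "'a measure \<Rightarrow> 'a measure \<Rightarrow> real" where
  "TV P Q = (SUP A\<in>sets P. \<bar>measure P A - measure Q A\<bar>)"

abbreviation seq_space :: "'a measure \<Rightarrow> (nat \<Rightarrow> 'a) measure" where
  "seq_space M \<equiv> (\<Pi>\<^sub>M i\<in>UNIV. M)"

text \<open>
  A test acts on pairs \<open>(x, u)\<close> of an observation sequence \<open>x\<close> and an internal random seed \<open>u\<close>,
  which has law \<open>R\<close> and is independent of the data.  The whole seed is available from time 0; this
  covers fresh randomness drawn at each step.  The observations are indexed from 0, so at time \<open>t\<close>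
  exactly \<open>x 0, \<dots>, x (t - 1)\<close> have been observed.  Only the measurable structure of \<open>M\<close> is
  used in the filtration.
\<close>

definition test_filtration ::
    "'a measure \<Rightarrow> 'r measure \<Rightarrow> enat \<Rightarrow> ((nat \<Rightarrow> 'a) \<times> 'r) measure" where
  "test_filtration M R t =
     vimage_algebra (space (seq_space M \<Otimes>\<^sub>M R))
       (\<lambda>(x, u). (restrict x {i. enat i < t}, u))
       ((\<Pi>\<^sub>M i\<in>{i. enat i < t}. M) \<Otimes>\<^sub>M R)"

text \<open>
  The value \<open>\<tau> = \<infinity>\<close> means that the test never stops; \<open>True\<close> and \<open>False\<close> encode the decisions
  1 and 0.
\<close>

definition sequential_test ::
    "'a measure \<Rightarrow> 'r measure \<Rightarrow> ((nat \<Rightarrow> 'a) \<times> 'r \<Rightarrow> enat) \<Rightarrow> ((nat \<Rightarrow> 'a) \<times> 'r \<Rightarrow> bool) \<Rightarrow> bool" where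
  "sequential_test M R \<tau> d \<longleftrightarrow>
     prob_space R \<and>
     stopping_time (test_filtration M R) \<tau> \<and>
     d \<in> filtration.pre_sigma (space (seq_space M \<Otimes>\<^sub>M R)) (test_filtration M R) \<tau>
           \<rightarrow>\<^sub>M count_space UNIV"

definition neighboring :: "(nat \<Rightarrow> 'a) \<Rightarrow> (nat \<Rightarrow> 'a) \<Rightarrow> bool" where
  "neighboring x x' \<longleftrightarrow> (\<exists>j. \<forall>i. i \<noteq> j \<longrightarrow> x i = x' i)"

definition differentially_private ::
    "real \<Rightarrow> 'a measure \<Rightarrow> 'r measure \<Rightarrow>
     ((nat \<Rightarrow> 'a) \<times> 'r \<Rightarrow> enat) \<Rightarrow> ((nat \<Rightarrow> 'a) \<times> 'r \<Rightarrow> bool) \<Rightarrow> bool" where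
  "differentially_private \<epsilon> M R \<tau> d \<longleftrightarrow>
     (\<forall>x\<in>space (seq_space M). \<forall>x'\<in>space (seq_space M). neighboring x x' \<longrightarrow>
       (\<forall>(t::nat) (b::bool).
          measure R {u \<in> space R. \<tau> (x, u) = enat t \<and> d (x, u) = b}
            \<le> exp \<epsilon> * measure R {u \<in> space R. \<tau> (x', u) = enat t \<and> d (x', u) = b}))"

text \<open>The joint law of i.i.d. observations from \<open>P\<close> and the independent seed.\<close>

definition joint_law :: "'a measure \<Rightarrow> 'r measure \<Rightarrow> ((nat \<Rightarrow> 'a) \<times> 'r) measure" where
  "joint_law P R = seq_space P \<Otimes>\<^sub>M R"

definition prob_decide ::
    "((nat \<Rightarrow> 'a) \<times> 'r) measure \<Rightarrow> ((nat \<Rightarrow> 'a) \<times> 'r \<Rightarrow> enat) \<Rightarrow> ((nat \<Rightarrow> 'a) \<times> 'r \<Rightarrow> bool) \<Rightarrow> bool \<Rightarrow> real" where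
  "prob_decide P \<tau> d b = measure P {\<omega> \<in> space P. \<tau> \<omega> < \<infinity> \<and> d \<omega> = b}"

definition expected_time ::
    "((nat \<Rightarrow> 'a) \<times> 'r) measure \<Rightarrow> ((nat \<Rightarrow> 'a) \<times> 'r \<Rightarrow> enat) \<Rightarrow> ennreal" where
  "expected_time P \<tau> = (\<integral>\<^sup>+\<omega>. ennreal_of_enat (\<tau> \<omega>) \<partial>P)"

lemma filtration_test_filtration:
  "filtration (space (seq_space M \<Otimes>\<^sub>M R)) (test_filtration M R)"
proof
  fix s t :: enat
  assume le: "s \<le> t"
  let ?\<Omega> = "space (seq_space M \<Otimes>\<^sub>M R)"
  let ?I = "\<lambda>t. {i. enat i < t}"
  let ?N = "\<lambda>t. (\<Pi>\<^sub>M i\<in>?I t. M) \<Otimes>\<^sub>M R"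
  let ?g = "\<lambda>t. \<lambda>(x :: nat \<Rightarrow> 'a, u :: 'b). (restrict x (?I t), u)"
  have sub: "?I s \<subseteq> ?I t"
    using le by auto
  have into: "?g t \<in> ?\<Omega> \<rightarrow> space (?N t)"
    by (auto simp: space_pair_measure space_PiM PiE_iff split: if_splits)
  have 1: "?g t \<in> test_filtration M R t \<rightarrow>\<^sub>M ?N t"
    unfolding test_filtration_def by (rule measurable_vimage_algebra1[OF into])
  have 2: "?g s \<in> ?N t \<rightarrow>\<^sub>M ?N s"
    unfolding case_prod_beta'
    by (intro measurable_Pair measurable_compose[OF measurable_fst]
          measurable_restrict_subset sub measurable_snd)
  have eq: "?g s = ?g s \<circ> ?g t"
    using sub by (auto simp: fun_eq_iff restrict_def)
  have "?g s \<in> test_filtration M R t \<rightarrow>\<^sub>M ?N s"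
    by (subst eq) (rule measurable_comp[OF 1 2])
  moreover have "space (test_filtration M R t) = ?\<Omega>"
    by (simp add: test_filtration_def)
  ultimately show "sets (test_filtration M R s) \<subseteq> sets (test_filtration M R t)"
    unfolding test_filtration_def[of M R s]
    by (metis sets_image_in_sets)
qed (simp add: test_filtration_def)

end

theory Submission
  imports Defs
begin

text \<open>
  Both bounds are instances of one change of measure. Realise the observations as \<open>f (z i)\<close> with
  \<open>z\<close> i.i.d., and let \<open>\<l>\<close> be an integrable increment such that weighting the event that the test stops
  at time \<open>t\<close> with decision \<open>b\<close> by \<open>exp (- (\<Sum>i<t. \<l> (z i)))\<close> under the first hypothesis gives at most
  its probability under the second. Let \<open>L\<close> be the sum of \<open>\<l> (z i)\<close> up to the stopping time. For any
  function \<open>G\<close> of the decision, \<open>1 + (G - L) \<le> exp (G - L)\<close> bounds the expectation of \<open>G - L\<close>, and by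
  Wald's identity the expectation of \<open>L\<close> is the expected stopping time times that of \<open>\<l>\<close>.
  For \<open>KL\<close>, \<open>\<l>\<close> is the log-likelihood ratio. For privacy, \<open>z\<close> is a maximal coupling of the
  two laws and \<open>\<l>\<close> is \<open>\<epsilon>\<close> times the indicator that the two coordinates differ: by group privacy,
  changing \<open>k\<close> observations costs a factor \<open>exp (k * \<epsilon>)\<close>.
\<close>

section \<open>Infinite products of one law\<close>

lemma measurable_comp_seq_space:
  assumes [measurable]: "f \<in> Q \<rightarrow>\<^sub>M N"
  shows "(\<lambda>z. f \<circ> z) \<in> seq_space Q \<rightarrow>\<^sub>M seq_space N"
  unfolding comp_def
  by (intro measurable_PiM_single') (auto simp: space_PiM intro: measurable_space[OF assms])

lemma measurable_comp_seq_space_pair: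
  assumes f [measurable]: "f \<in> Q \<rightarrow>\<^sub>M N"
  shows "(\<lambda>(z, u). (f \<circ> z, u)) \<in> seq_space Q \<Otimes>\<^sub>M R \<rightarrow>\<^sub>M seq_space N \<Otimes>\<^sub>M R"
  unfolding case_prod_beta'
  by (intro measurable_Pair measurable_snd measurable_compose[OF measurable_fst]
      measurable_comp_seq_space[OF f])

text \<open>Measures on a product agree once they agree on finite-dimensional cylinders, and
  applying \<open>f\<close> coordinatewise pulls a cylinder back to the cylinder over the preimages.
  So i.i.d. observations of law \<open>distr Q N f\<close> can be simulated on
  \<open>seq_space Q\<close>.\<close>

lemma distr_seq_space:
  assumes "prob_space Q" and f [measurable]: "f \<in> Q \<rightarrow>\<^sub>M N"
  shows "distr (seq_space Q) (seq_space N) (\<lambda>z. f \<circ> z) = seq_space (distr Q N f)"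
proof -
  interpret Q: prob_space Q by fact
  interpret P: prob_space "distr Q N f" by (rule Q.prob_space_distr[OF f])
  interpret PP: product_prob_space "\<lambda>_::nat. distr Q N f" UNIV ..
  interpret QQ: product_prob_space "\<lambda>_::nat. Q" UNIV ..
  show ?thesis
  proof (rule PP.PiM_eq)
    show "sets (distr (seq_space Q) (seq_space N) (\<lambda>z. f \<circ> z)) = sets (seq_space (distr Q N f))"
      by (simp cong: sets_PiM_cong)
  next
    fix J :: "nat set" and F :: "nat \<Rightarrow> _"
    assume J: "finite J" "J \<subseteq> UNIV" and F: "\<And>j. j \<in> J \<Longrightarrow> F j \<in> sets (distr Q N f)"
    have "prod_emb UNIV (\<lambda>_. distr Q N f) J (Pi\<^sub>E J F) = prod_emb UNIV (\<lambda>_. N) J (Pi\<^sub>E J F)"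
      by (simp add: prod_emb_def)
    also have "\<dots> \<in> sets (seq_space N)"
      using J F by (intro sets_PiM_I) auto
    finally have "prod_emb UNIV (\<lambda>_. distr Q N f) J (Pi\<^sub>E J F) \<in> sets (seq_space N)" .
    moreover have "(\<lambda>z. f \<circ> z) -` prod_emb UNIV (\<lambda>_. distr Q N f) J (Pi\<^sub>E J F) \<inter> space (seq_space Q)
        = prod_emb UNIV (\<lambda>_. Q) J (\<Pi>\<^sub>E j\<in>J. f -` F j \<inter> space Q)"
      using measurable_space[OF f] by (auto simp: prod_emb_def space_PiM PiE_iff)
    moreover have "emeasure (seq_space Q) (prod_emb UNIV (\<lambda>_. Q) J (\<Pi>\<^sub>E j\<in>J. f -` F j \<inter> space Q))
        = (\<Prod>j\<in>J. emeasure Q (f -` F j \<inter> space Q))"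
      using J F by (intro QQ.emeasure_PiM_emb measurable_sets[OF f]) auto
    moreover have "(\<Prod>j\<in>J. emeasure Q (f -` F j \<inter> space Q)) = (\<Prod>j\<in>J. emeasure (distr Q N f) (F j))"
      using F by (intro prod.cong emeasure_distr[OF f, symmetric]) simp_all
    ultimately show "emeasure (distr (seq_space Q) (seq_space N) (\<lambda>z. f \<circ> z))
        (prod_emb UNIV (\<lambda>_. distr Q N f) J (Pi\<^sub>E J F)) = (\<Prod>j\<in>J. emeasure (distr Q N f) (F j))"
      by (simp only: emeasure_distr[OF measurable_comp_seq_space[OF f]])
  qed
qed

lemma distr_seq_space_pair:
  assumes Q: "prob_space Q" and R: "prob_space R" and f [measurable]: "f \<in> Q \<rightarrow>\<^sub>M N"
  shows "distr (seq_space Q \<Otimes>\<^sub>M R) (seq_space N \<Otimes>\<^sub>M R) (\<lambda>(z, u). (f \<circ> z, u))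
    = seq_space (distr Q N f) \<Otimes>\<^sub>M R"
proof -
  interpret R: prob_space R by fact
  have "prob_space (seq_space (distr Q N f))"
    by (intro prob_space_PiM prob_space.prob_space_distr Q f)
  then have "sigma_finite_measure (distr R R (\<lambda>u. u))"
    by (simp add: distr_id R.sigma_finite_measure_axioms)
  then have "distr (seq_space Q) (seq_space N) (\<lambda>z. f \<circ> z) \<Otimes>\<^sub>M distr R R (\<lambda>u. u)
     = distr (seq_space Q \<Otimes>\<^sub>M R) (seq_space N \<Otimes>\<^sub>M R) (\<lambda>(z, u). (f \<circ> z, u))"
    by (intro pair_measure_distr measurable_comp_seq_space[OF f] measurable_ident_sets refl)
  then show ?thesis
    by (simp add: distr_id distr_seq_space[OF Q f])
qed

text \<open>On a cylinder the constraint on coordinate \<open>i\<close> moves to the fresh draw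
  while the others stay with the old sequence, so the masses multiply to the same product. This
  invariance expresses the independence of coordinate \<open>i\<close> from all others.\<close>

lemma distr_seq_space_resample:
  fixes Q :: "'a measure"
  assumes Q: "prob_space Q"
  shows "distr (seq_space Q \<Otimes>\<^sub>M Q) (seq_space Q) (\<lambda>(z, y). z(i := y)) = seq_space Q"
proof -
  interpret Q: prob_space Q by fact
  interpret QQ: product_prob_space "\<lambda>_::nat. Q" UNIV ..
  have upd [measurable]: "(\<lambda>(z, y). z(i := y)) \<in> seq_space Q \<Otimes>\<^sub>M Q \<rightarrow>\<^sub>M seq_space Q"
    by (intro measurable_PiM_single') (auto simp: space_pair_measure space_PiM split: if_splits)
  show ?thesis
  proof (rule QQ.PiM_eq)
    fix J :: "nat set" and F :: "nat \<Rightarrow> _"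
    assume J: "finite J" "J \<subseteq> UNIV" and F: "\<And>j. j \<in> J \<Longrightarrow> F j \<in> sets Q"
    \<comment> \<open>If the cylinder leaves coordinate \<open>i\<close> free, the fresh draw is
      unconstrained and contributes the factor 1.\<close>
    let ?B = "if i \<in> J then F i else space Q"
    let ?A = "prod_emb UNIV (\<lambda>_. Q) (J - {i}) (Pi\<^sub>E (J - {i}) F)"
    have "(\<lambda>(z, y). z(i := y)) -` prod_emb UNIV (\<lambda>_. Q) J (Pi\<^sub>E J F) \<inter> space (seq_space Q \<Otimes>\<^sub>M Q)
        = ?A \<times> ?B" (is "?L = _")
    proof (rule set_eqI)
      fix w :: "(nat \<Rightarrow> 'a) \<times> 'a"
      obtain z y where w: "w = (z, y)" by (cases w)
      have sub: "j \<in> J \<Longrightarrow> F j \<subseteq> space Q" for j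
        using F sets.sets_into_space by blast
      have emb: "x \<in> prod_emb UNIV (\<lambda>_. Q) K (Pi\<^sub>E K F) \<longleftrightarrow> (\<forall>j. x j \<in> space Q) \<and> (\<forall>j\<in>K. x j \<in> F j)"
        for x K by (auto simp: prod_emb_def PiE_iff restrict_PiE_iff)
      have "(\<forall>j\<in>J. (z(i := y)) j \<in> F j) \<longleftrightarrow> (\<forall>j\<in>J - {i}. z j \<in> F j) \<and> (i \<in> J \<longrightarrow> y \<in> F i)"
        by (metis Diff_iff fun_upd_apply singletonD singletonI)
      then have L: "(z, y) \<in> ?L \<longleftrightarrow> (\<forall>j. z j \<in> space Q) \<and> y \<in> space Q \<and>
          (\<forall>j\<in>J - {i}. z j \<in> F j) \<and> (i \<in> J \<longrightarrow> y \<in> F i)"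
        by (auto simp: emb space_PiM PiE_iff space_pair_measure)
      show "w \<in> ?L \<longleftrightarrow> w \<in> ?A \<times> ?B"
        unfolding w L using sub by (auto simp: emb)
    qed
    moreover have "?A \<in> sets (seq_space Q)"
      using J F by (intro sets_PiM_I) auto
    moreover have "?B \<in> sets Q"
      using F by simp
    moreover have "prod_emb UNIV (\<lambda>_. Q) J (Pi\<^sub>E J F) \<in> sets (seq_space Q)"
      using J F by (intro sets_PiM_I) auto
    ultimately have "emeasure (distr (seq_space Q \<Otimes>\<^sub>M Q) (seq_space Q) (\<lambda>(z, y). z(i := y)))
        (prod_emb UNIV (\<lambda>_. Q) J (Pi\<^sub>E J F)) = emeasure (seq_space Q) ?A * emeasure Q ?B"
      by (simp only: emeasure_distr[OF upd] Q.emeasure_pair_measure_Times)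
    also have "emeasure (seq_space Q) ?A = (\<Prod>j\<in>J - {i}. emeasure Q (F j))"
      using J F by (intro QQ.emeasure_PiM_emb) auto
    also have "\<dots> * emeasure Q ?B = (\<Prod>j\<in>J. emeasure Q (F j))"
    proof (cases "i \<in> J")
      case True
      then show ?thesis using J by (simp add: prod.remove[of J i] mult.commute)
    qed (simp add: Q.emeasure_space_1)
    finally show "emeasure (distr (seq_space Q \<Otimes>\<^sub>M Q) (seq_space Q) (\<lambda>(z, y). z(i := y)))
        (prod_emb UNIV (\<lambda>_. Q) J (Pi\<^sub>E J F)) = (\<Prod>j\<in>J. emeasure Q (F j))" .
  qed simp
qed

text \<open>Redraw coordinate \<open>i\<close> as an independent \<open>y\<close>: \<open>g\<close>
  does not notice and \<open>h\<close> sees only \<open>y\<close>, so Tonelli separates the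
  two.\<close>

lemma nn_integral_seq_space_indep:
  assumes Q: "prob_space Q"
    and g: "g \<in> borel_measurable (seq_space Q)"
    and h: "h \<in> borel_measurable Q"
    and upd: "\<And>z y. z \<in> space (seq_space Q) \<Longrightarrow> y \<in> space Q \<Longrightarrow> g (z(i := y)) = g z"
  shows "(\<integral>\<^sup>+z. g z * h (z i) \<partial>seq_space Q) = (\<integral>\<^sup>+z. g z \<partial>seq_space Q) * (\<integral>\<^sup>+y. h y \<partial>Q)"
proof -
  interpret Q: prob_space Q by fact
  have upd': "(\<lambda>(z, y). z(i := y)) \<in> seq_space Q \<Otimes>\<^sub>M Q \<rightarrow>\<^sub>M seq_space Q"
    by (intro measurable_PiM_single') (auto simp: space_pair_measure space_PiM split: if_splits)
  have meas: "(\<lambda>z. g z * h (z i)) \<in> borel_measurable (seq_space Q)"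
    by (intro borel_measurable_times_ennreal g measurable_compose[where f = "\<lambda>z. z i" and g = h and N = Q] h) simp
  have "(\<integral>\<^sup>+z. g z * h (z i) \<partial>seq_space Q)
      = (\<integral>\<^sup>+z. g z * h (z i) \<partial>distr (seq_space Q \<Otimes>\<^sub>M Q) (seq_space Q) (\<lambda>(z, y). z(i := y)))"
    by (simp add: distr_seq_space_resample[OF Q])
  also have "\<dots> = (\<integral>\<^sup>+w. g ((fst w)(i := snd w)) * h (snd w) \<partial>(seq_space Q \<Otimes>\<^sub>M Q))"
    by (subst nn_integral_distr[OF upd']) (simp_all add: meas case_prod_beta')
  also have "\<dots> = (\<integral>\<^sup>+w. g (fst w) * h (snd w) \<partial>(seq_space Q \<Otimes>\<^sub>M Q))"
    by (rule nn_integral_cong) (simp add: upd space_pair_measure mem_Times_iff)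
  also have "\<dots> = (\<integral>\<^sup>+z. g z * (\<integral>\<^sup>+y. h y \<partial>Q) \<partial>seq_space Q)"
  proof -
    have "(\<lambda>w. g (fst w) * h (snd w)) \<in> borel_measurable (seq_space Q \<Otimes>\<^sub>M Q)"
      by (intro borel_measurable_times_ennreal measurable_compose[OF measurable_fst g]
          measurable_compose[OF measurable_snd h])
    from Q.nn_integral_fst[OF this] show ?thesis
      by (simp add: nn_integral_cmult h)
  qed
  finally show ?thesis by (simp add: nn_integral_multc g)
qed

section \<open>Events determined by finitely many observations\<close>

lemma measurable_test_filtration_map:
  "(\<lambda>(x, u). (restrict x {i. enat i < t}, u))
     \<in> seq_space M \<Otimes>\<^sub>M R \<rightarrow>\<^sub>M (\<Pi>\<^sub>M i\<in>{i. enat i < t}. M) \<Otimes>\<^sub>M R"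
  unfolding case_prod_beta'
  by (intro measurable_Pair measurable_compose[OF measurable_fst]
      measurable_restrict_subset measurable_snd) auto

lemma sets_test_filtration_subset:
  "sets (test_filtration M R t) \<subseteq> sets (seq_space M \<Otimes>\<^sub>M R)"
  unfolding test_filtration_def
  by (rule sets_image_in_sets[OF refl measurable_test_filtration_map])

text \<open>Events at time \<open>t\<close> are preimages under a map that keeps only the seed and
  the coordinates below \<open>t\<close>, so they cannot separate sequences with equal
  images.\<close>

lemma test_filtration_cong:
  assumes E: "E \<in> sets (test_filtration M R (enat t))"
    and x: "x \<in> space (seq_space M)" and x': "x' \<in> space (seq_space M)"
    and eq: "\<And>i. i < t \<Longrightarrow> x i = x' i" and u: "u \<in> space R"
  shows "(x, u) \<in> E \<longleftrightarrow> (x', u) \<in> E"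
proof -
  let ?I = "{i. enat i < enat t}"
  have into: "(\<lambda>(x, u). (restrict x ?I, u)) \<in> space (seq_space M \<Otimes>\<^sub>M R)
      \<rightarrow> space ((\<Pi>\<^sub>M i\<in>?I. M) \<Otimes>\<^sub>M R)"
    using measurable_test_filtration_map[of "enat t" M R] by (rule measurable_space[THEN funcsetI])
  obtain B where "E = (\<lambda>(x, u). (restrict x ?I, u)) -` B \<inter> space (seq_space M \<Otimes>\<^sub>M R)"
    using E unfolding test_filtration_def sets_vimage_algebra2[OF into] by auto
  moreover have "restrict x ?I = restrict x' ?I"
    using eq by (auto simp: restrict_def fun_eq_iff)
  ultimately show ?thesis
    using x x' u by (simp add: space_pair_measure)
qed

locale seq_test =
  fixes M :: "'a measure" and R :: "'r measure"
    and \<tau> :: "(nat \<Rightarrow> 'a) \<times> 'r \<Rightarrow> enat" and d :: "(nat \<Rightarrow> 'a) \<times> 'r \<Rightarrow> bool"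
  assumes sequential_test: "sequential_test M R \<tau> d"
begin

sublocale R: prob_space R
  using sequential_test unfolding sequential_test_def by (elim conjE)

sublocale filtration "space (seq_space M \<Otimes>\<^sub>M R)" "test_filtration M R"
  by (rule filtration_test_filtration)

lemma stop: "stopping_time (test_filtration M R) \<tau>"
  using sequential_test unfolding sequential_test_def by (elim conjE)

definition stop_event :: "nat \<Rightarrow> bool \<Rightarrow> ((nat \<Rightarrow> 'a) \<times> 'r) set" where
  "stop_event t b = {\<omega> \<in> space (seq_space M \<Otimes>\<^sub>M R). \<tau> \<omega> = enat t \<and> d \<omega> = b}"

text \<open>The kernel of the mechanism: the observations are held fixed and only the seed is
  random, as in \<open>differentially_private\<close>.\<close>

definition stop_prob :: "nat \<Rightarrow> bool \<Rightarrow> (nat \<Rightarrow> 'a) \<Rightarrow> ennreal" where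
  "stop_prob t b x = emeasure R {u \<in> space R. \<tau> (x, u) = enat t \<and> d (x, u) = b}"

text \<open>The first \<open>t\<close> observations have indices below \<open>t\<close>, so whether
  the test runs past time \<open>t\<close> is settled before \<open>x t\<close> is seen. This
  indexing yields the independence in Wald's identity.\<close>

lemma continue_filtration:
  "{\<omega> \<in> space (seq_space M \<Otimes>\<^sub>M R). enat t < \<tau> \<omega>} \<in> sets (test_filtration M R (enat t))"
  using stopping_timeD2[OF stop] unfolding pred_def space_F .

text \<open>\<open>pre_sigma\<close> only speaks of stopping by time \<open>t\<close>. Equality is
  recovered by intersecting with the event of running past the predecessor \<open>s\<close>, which
  is already known at time \<open>s\<close>; at time 0 there is nothing to remove.\<close>

lemma stop_event_filtration: "stop_event t b \<in> sets (test_filtration M R (enat t))"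
proof -
  have "d \<in> pre_sigma \<tau> \<rightarrow>\<^sub>M count_space UNIV"
    using sequential_test unfolding sequential_test_def by (elim conjE)
  then have "d -` {b} \<inter> space (pre_sigma \<tau>) \<in> sets (pre_sigma \<tau>)"
    by (rule measurable_sets) simp
  then have "{\<omega> \<in> d -` {b} \<inter> space (pre_sigma \<tau>). \<tau> \<omega> \<le> enat t} \<in> sets (test_filtration M R (enat t))"
    by (rule sets_pre_sigmaD[OF stop])
  also have "{\<omega> \<in> d -` {b} \<inter> space (pre_sigma \<tau>). \<tau> \<omega> \<le> enat t}
      = {\<omega> \<in> space (seq_space M \<Otimes>\<^sub>M R). d \<omega> = b \<and> \<tau> \<omega> \<le> enat t}"
    unfolding space_pre_sigma by blast
  finally have 1: "{\<omega> \<in> space (seq_space M \<Otimes>\<^sub>M R). d \<omega> = b \<and> \<tau> \<omega> \<le> enat t}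
      \<in> sets (test_filtration M R (enat t))" .
  show ?thesis
  proof (cases t)
    case 0
    have "stop_event t b = {\<omega> \<in> space (seq_space M \<Otimes>\<^sub>M R). d \<omega> = b \<and> \<tau> \<omega> \<le> enat t}"
      unfolding stop_event_def 0 by (intro Collect_cong) (auto simp: zero_enat_def[symmetric])
    then show ?thesis using 1 by (simp only:)
  next
    case (Suc s)
    have "{\<omega> \<in> space (seq_space M \<Otimes>\<^sub>M R). enat s < \<tau> \<omega>} \<in> sets (test_filtration M R (enat t))"
      by (rule subsetD[OF sets_F_mono continue_filtration]) (simp add: Suc)
    with 1 have "{\<omega> \<in> space (seq_space M \<Otimes>\<^sub>M R). d \<omega> = b \<and> \<tau> \<omega> \<le> enat t}
       \<inter> {\<omega> \<in> space (seq_space M \<Otimes>\<^sub>M R). enat s < \<tau> \<omega>} \<in> sets (test_filtration M R (enat t))"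
      by (rule sets.Int)
    also have "{\<omega> \<in> space (seq_space M \<Otimes>\<^sub>M R). d \<omega> = b \<and> \<tau> \<omega> \<le> enat t}
       \<inter> {\<omega> \<in> space (seq_space M \<Otimes>\<^sub>M R). enat s < \<tau> \<omega>} = stop_event t b"
    proof -
      have "\<tau> \<omega> = enat t \<longleftrightarrow> \<tau> \<omega> \<le> enat t \<and> enat s < \<tau> \<omega>" for \<omega>
        using Suc by (cases "\<tau> \<omega>") auto
      then show ?thesis unfolding stop_event_def by blast
    qed
    finally show ?thesis .
  qed
qed

lemma sets_stop_event: "stop_event t b \<in> sets (seq_space M \<Otimes>\<^sub>M R)"
  by (rule subsetD[OF sets_test_filtration_subset stop_event_filtration])

lemma sets_continue:
  "{\<omega> \<in> space (seq_space M \<Otimes>\<^sub>M R). enat t < \<tau> \<omega>} \<in> sets (seq_space M \<Otimes>\<^sub>M R)"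
  by (rule subsetD[OF sets_test_filtration_subset continue_filtration])

lemma stop_prob_eq:
  "x \<in> space (seq_space M) \<Longrightarrow> stop_prob t b x = emeasure R (Pair x -` stop_event t b)"
  unfolding stop_prob_def stop_event_def
  by (simp add: space_pair_measure vimage_def)

lemma measurable_stop_prob: "stop_prob t b \<in> borel_measurable (seq_space M)"
  using R.measurable_emeasure_Pair[OF sets_stop_event] by (simp only: measurable_cong[OF stop_prob_eq])

text \<open>Stopping at \<open>t\<close> cannot depend on observations from index \<open>t\<close>
  on. Both bounds rely on this to reduce infinite sequences to their first \<open>t\<close>
  entries.\<close>

lemma stop_prob_cong:
  assumes "x \<in> space (seq_space M)" "x' \<in> space (seq_space M)" "\<And>i. i < t \<Longrightarrow> x i = x' i"
  shows "stop_prob t b x = stop_prob t b x'"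
proof -
  have "(x, u) \<in> stop_event t b \<longleftrightarrow> (x', u) \<in> stop_event t b" if "u \<in> space R" for u
    using test_filtration_cong[OF stop_event_filtration assms that] .
  then have "{u \<in> space R. \<tau> (x, u) = enat t \<and> d (x, u) = b} = {u \<in> space R. \<tau> (x', u) = enat t \<and> d (x', u) = b}"
    using assms(1,2) by (intro Collect_cong) (auto simp: stop_event_def space_pair_measure)
  then show ?thesis by (simp only: stop_prob_def)
qed

end

section \<open>Stopped sums and change of measure\<close>

text \<open>Counting the indices below \<open>n\<close> turns an expected time into a sum of tail
  probabilities. The value \<open>\<infinity>\<close> is covered as a divergent series.\<close>

lemma ennreal_of_enat_eq_suminf:
  "ennreal_of_enat n = (\<Sum>i. if enat i < n then 1 else 0)"
proof (cases n)
  case (enat m)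
  have "(\<Sum>i. if enat i < n then 1 else 0 :: ennreal) = (\<Sum>i<m. if enat i < n then 1 else 0)"
    by (rule suminf_finite) (auto simp: enat)
  then show ?thesis by (simp add: enat)
next
  case infinity
  have "(\<Sum>i. 1 :: ennreal) = (SUP m. of_nat m)"
    by (subst suminf_eq_SUP) auto
  then show ?thesis by (simp add: infinity ennreal_SUP_of_nat_eq_top)
qed

text \<open>\<open>enn2real\<close> sends \<open>\<infinity>\<close> to 0, but a finite integral
  confines that value to a null set. This is the passage from \<open>ennreal\<close> to integrals of
  signed functions.\<close>

lemma integral_enn2real:
  assumes X: "X \<in> borel_measurable N" and fin: "(\<integral>\<^sup>+w. X w \<partial>N) \<noteq> \<infinity>"
  shows "integrable N (\<lambda>w. enn2real (X w))" and "(\<integral>w. enn2real (X w) \<partial>N) = enn2real (\<integral>\<^sup>+w. X w \<partial>N)"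
proof -
  have "AE w in N. X w \<noteq> \<infinity>"
    by (rule nn_integral_PInf_AE[OF X fin])
  then have eq: "(\<integral>\<^sup>+w. ennreal (enn2real (X w)) \<partial>N) = (\<integral>\<^sup>+w. X w \<partial>N)"
    by (intro nn_integral_cong_AE) (auto simp: top.not_eq_extremum)
  have m: "(\<lambda>w. enn2real (X w)) \<in> borel_measurable N"
    using X by measurable
  show "integrable N (\<lambda>w. enn2real (X w))"
    using fin by (intro integrableI_nonneg m) (auto simp: eq top.not_eq_extremum)
  show "(\<integral>w. enn2real (X w) \<partial>N) = enn2real (\<integral>\<^sup>+w. X w \<partial>N)"
    by (subst integral_eq_nn_integral[OF m]) (simp_all add: eq)
qed

context seq_test begin

lemma sets_joint_law: "sets P = sets M \<Longrightarrow> sets (joint_law P R) = sets (seq_space M \<Otimes>\<^sub>M R)"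
  unfolding joint_law_def by (intro sets_pair_measure_cong sets_PiM_cong refl)

lemma space_joint_law: "sets P = sets M \<Longrightarrow> space (joint_law P R) = space (seq_space M \<Otimes>\<^sub>M R)"
  by (rule sets_eq_imp_space_eq[OF sets_joint_law])

lemma expected_time_eq_suminf:
  assumes "sets P = sets M"
  shows "expected_time (joint_law P R) \<tau>
    = (\<Sum>i. emeasure (joint_law P R) {\<omega> \<in> space (seq_space M \<Otimes>\<^sub>M R). enat i < \<tau> \<omega>})"
proof -
  have "expected_time (joint_law P R) \<tau> = (\<integral>\<^sup>+\<omega>. (\<Sum>i. indicator
      {\<omega> \<in> space (seq_space M \<Otimes>\<^sub>M R). enat i < \<tau> \<omega>} \<omega>) \<partial>joint_law P R)"
    unfolding expected_time_def ennreal_of_enat_eq_suminf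
    by (rule nn_integral_cong) (simp add: space_joint_law[OF assms] indicator_def of_bool_def)
  also have "\<dots> = (\<Sum>i. \<integral>\<^sup>+\<omega>. indicator
      {\<omega> \<in> space (seq_space M \<Otimes>\<^sub>M R). enat i < \<tau> \<omega>} \<omega> \<partial>joint_law P R)"
    by (rule nn_integral_suminf, rule borel_measurable_indicator)
      (simp only: sets_joint_law[OF assms] sets_continue)
  also have "\<dots> = (\<Sum>i. emeasure (joint_law P R) {\<omega> \<in> space (seq_space M \<Otimes>\<^sub>M R). enat i < \<tau> \<omega>})"
    by (subst nn_integral_indicator) (simp_all only: sets_joint_law[OF assms] sets_continue)
  finally show ?thesis .
qed

lemma decide_eq_UN:
  assumes "sets P = sets M"
  shows "{\<omega> \<in> space (joint_law P R). \<tau> \<omega> < \<infinity> \<and> d \<omega> = b} = (\<Union>t. stop_event t b)"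
  unfolding space_joint_law[OF assms] stop_event_def by (auto elim: less_infinityE)

text \<open>Stopping with decision \<open>b\<close> is the disjoint union of the events
  \<open>stop_event t b\<close>; integrating out the seed first turns each into
  \<open>stop_prob\<close>, the form in which laws are compared.\<close>

lemma emeasure_decide:
  assumes P: "prob_space P" and sets: "sets P = sets M"
  shows "emeasure (joint_law P R) {\<omega> \<in> space (joint_law P R). \<tau> \<omega> < \<infinity> \<and> d \<omega> = b}
    = (\<Sum>t. \<integral>\<^sup>+x. stop_prob t b x \<partial>seq_space P)"
proof -
  note decide_eq_UN[OF sets, of b]
  moreover have "(\<Sum>t. emeasure (joint_law P R) (stop_event t b)) = emeasure (joint_law P R) (\<Union>t. stop_event t b)"
  proof (rule suminf_emeasure)
    show "range (\<lambda>t. stop_event t b) \<subseteq> sets (joint_law P R)"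
      unfolding sets_joint_law[OF sets] using sets_stop_event by blast
    show "disjoint_family (\<lambda>t. stop_event t b)"
      by (auto simp: disjoint_family_on_def stop_event_def)
  qed
  moreover have "emeasure (joint_law P R) (stop_event t b) = (\<integral>\<^sup>+x. stop_prob t b x \<partial>seq_space P)" for t
  proof -
    have sp: "space (seq_space P) = space (seq_space M)"
      using sets_eq_imp_space_eq[OF sets] by (simp add: space_PiM)
    have "stop_event t b \<in> sets (seq_space P \<Otimes>\<^sub>M R)"
      using sets_stop_event sets_joint_law[OF sets] by (simp only: joint_law_def)
    then have "emeasure (joint_law P R) (stop_event t b) = (\<integral>\<^sup>+x. emeasure R (Pair x -` stop_event t b) \<partial>seq_space P)"
      unfolding joint_law_def by (rule R.emeasure_pair_measure_alt)
    also have "\<dots> = (\<integral>\<^sup>+x. stop_prob t b x \<partial>seq_space P)"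
      by (rule nn_integral_cong) (simp add: sp stop_prob_eq)
    finally show ?thesis .
  qed
  ultimately show ?thesis by simp
qed

text \<open>Resampling \<open>z i\<close> alters only observation \<open>i\<close>, which comes too
  late to influence whether the test runs past time \<open>i\<close>.\<close>

lemma continue_upd:
  assumes f: "f \<in> Q \<rightarrow>\<^sub>M M" and z: "z \<in> space (seq_space Q)" "y \<in> space Q" and u: "u \<in> space R"
  shows "enat i < \<tau> (f \<circ> z(i := y), u) \<longleftrightarrow> enat i < \<tau> (f \<circ> z, u)"
proof -
  have sp: "f \<circ> z(i := y) \<in> space (seq_space M)" "f \<circ> z \<in> space (seq_space M)"
    using z measurable_space[OF f] by (auto simp: space_PiM PiE_iff)
  have "(f \<circ> z(i := y), u) \<in> {\<omega> \<in> space (seq_space M \<Otimes>\<^sub>M R). enat i < \<tau> \<omega>}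
    \<longleftrightarrow> (f \<circ> z, u) \<in> {\<omega> \<in> space (seq_space M \<Otimes>\<^sub>M R). enat i < \<tau> \<omega>}"
    by (rule test_filtration_cong[OF continue_filtration sp _ u]) simp
  then show ?thesis using sp u by (simp add: space_pair_measure)
qed

text \<open>The increment \<open>h (z i)\<close> is counted on \<open>C i\<close>, an event
  determined by the seed and the samples before index \<open>i\<close>, so each term factors into
  the probability of \<open>C i\<close> and the mean of \<open>h\<close>. The probabilities add up
  to the expected time. In \<open>ennreal\<close>, sums and integrals interchange freely; a signed
  increment enters through its two parts.\<close>

lemma wald:
  fixes Q :: "'z measure"
  assumes Q: "prob_space Q" and f: "f \<in> Q \<rightarrow>\<^sub>M M" and h: "h \<in> borel_measurable Q"
  defines "C i \<equiv> {w \<in> space (seq_space Q \<Otimes>\<^sub>M R). enat i < \<tau> (f \<circ> fst w, snd w)}"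
  shows "\<And>i. C i \<in> sets (seq_space Q \<Otimes>\<^sub>M R)"
    and "(\<lambda>w. \<Sum>i. indicator (C i) w * h (fst w i)) \<in> borel_measurable (seq_space Q \<Otimes>\<^sub>M R)"
    and "(\<integral>\<^sup>+w. (\<Sum>i. indicator (C i) w * h (fst w i)) \<partial>(seq_space Q \<Otimes>\<^sub>M R))
      = expected_time (joint_law (distr Q M f) R) \<tau> * (\<integral>\<^sup>+y. h y \<partial>Q)"
proof -
  let ?W = "seq_space Q \<Otimes>\<^sub>M R"
  let ?K = "\<lambda>i. {\<omega> \<in> space (seq_space M \<Otimes>\<^sub>M R). enat i < \<tau> \<omega>}"
  interpret QQ: prob_space "seq_space Q" by (rule prob_space_PiM[OF Q])
  interpret pair_sigma_finite "seq_space Q" R ..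
  note map = measurable_comp_seq_space_pair[OF f, of R]
  have C_eq: "C i = (\<lambda>(z, u). (f \<circ> z, u)) -` ?K i \<inter> space ?W" for i
    using measurable_space[OF map] unfolding C_def by (auto simp: case_prod_beta')
  show C: "C i \<in> sets ?W" for i
    unfolding C_eq by (rule measurable_sets[OF map sets_continue])
  have m: "(\<lambda>w. indicator (C i) w * h (fst w i)) \<in> borel_measurable ?W" for i
    by (intro borel_measurable_times_ennreal borel_measurable_indicator C
        measurable_compose[OF measurable_fst measurable_compose[where f = "\<lambda>z. z i" and g = h and N = Q]] h) simp
  then show "(\<lambda>w. \<Sum>i. indicator (C i) w * h (fst w i)) \<in> borel_measurable ?W"
    by (rule borel_measurable_suminf_order)
  have "(\<integral>\<^sup>+w. indicator (C i) w * h (fst w i) \<partial>?W) = emeasure ?W (C i) * (\<integral>\<^sup>+y. h y \<partial>Q)" for i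
  proof -
    have "(\<integral>\<^sup>+w. indicator (C i) w * h (fst w i) \<partial>?W)
        = (\<integral>\<^sup>+u. (\<integral>\<^sup>+z. indicator (C i) (z, u) * h (z i) \<partial>seq_space Q) \<partial>R)"
      by (subst nn_integral_snd[OF m, symmetric]) simp
    also have "\<dots> = (\<integral>\<^sup>+u. (\<integral>\<^sup>+z. indicator (C i) (z, u) \<partial>seq_space Q) * (\<integral>\<^sup>+y. h y \<partial>Q) \<partial>R)"
    \<comment> \<open>The seed is integrated last: for each fixed \<open>u\<close> only the sequence
      is random, and coordinate \<open>i\<close> can be split off.\<close>
    proof (rule nn_integral_cong, rule nn_integral_seq_space_indep[OF Q _ h])
      fix u assume u: "u \<in> space R"
      show "(\<lambda>z. indicator (C i) (z, u) :: ennreal) \<in> borel_measurable (seq_space Q)"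
        by (rule measurable_compose[OF measurable_Pair2'[OF u] borel_measurable_indicator[OF C]])
      fix z y assume zy: "z \<in> space (seq_space Q)" "y \<in> space Q"
      then have "z(i := y) \<in> space (seq_space Q)"
        by (auto simp: space_PiM PiE_iff)
      then show "indicator (C i) (z(i := y), u) = (indicator (C i) (z, u) :: ennreal)"
        using zy u continue_upd[OF f zy u, of i] by (simp add: C_def indicator_def space_pair_measure)
    qed
    also have "\<dots> = (\<integral>\<^sup>+u. (\<integral>\<^sup>+z. indicator (C i) (z, u) \<partial>seq_space Q) \<partial>R) * (\<integral>\<^sup>+y. h y \<partial>Q)"
      by (rule nn_integral_multc) (rule QQ.borel_measurable_nn_integral_fst[OF measurable_pair_swap[OF
          borel_measurable_indicator[OF C]], unfolded case_prod_conv])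
    also have "(\<integral>\<^sup>+u. (\<integral>\<^sup>+z. indicator (C i) (z, u) \<partial>seq_space Q) \<partial>R) = emeasure ?W (C i)"
      by (subst nn_integral_snd[OF borel_measurable_indicator[OF C]]) (rule nn_integral_indicator[OF C])
    finally show ?thesis .
  qed
  then have "(\<integral>\<^sup>+w. (\<Sum>i. indicator (C i) w * h (fst w i)) \<partial>?W) = (\<Sum>i. emeasure ?W (C i)) * (\<integral>\<^sup>+y. h y \<partial>Q)"
    by (simp add: nn_integral_suminf[OF m])
  also have "(\<Sum>i. emeasure ?W (C i)) = expected_time (joint_law (distr Q M f) R) \<tau>"
  proof -
    have "emeasure (joint_law (distr Q M f) R) (?K i) = emeasure ?W (C i)" for i
      unfolding joint_law_def distr_seq_space_pair[OF Q R.prob_space_axioms f, symmetric] C_eq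
      by (rule emeasure_distr[OF map sets_continue])
    then show ?thesis by (simp add: expected_time_eq_suminf)
  qed
  finally show "(\<integral>\<^sup>+w. (\<Sum>i. indicator (C i) w * h (fst w i)) \<partial>?W)
      = expected_time (joint_law (distr Q M f) R) \<tau> * (\<integral>\<^sup>+y. h y \<partial>Q)" .
qed

text \<open>\<open>c\<close> is the correct decision under the first law \<open>distr Q M f\<close>,
  so \<open>err0\<close> and \<open>err1\<close> bound the two error probabilities; keeping
  \<open>c\<close> variable serves both directions. The sample space of \<open>Q\<close> lets the
  increment depend on more than the observation, as a coupling requires.\<close>

lemma change_of_measure_bound:
  fixes Q :: "'z measure" and P1 :: "'a measure" and \<l> :: "'z \<Rightarrow> real"
  assumes Q: "prob_space Q" and f: "f \<in> Q \<rightarrow>\<^sub>M M" and l: "integrable Q \<l>"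
    and P1: "prob_space P1" "sets P1 = sets M"
    and change: "\<And>t b. (\<integral>\<^sup>+z. ennreal (exp (- (\<Sum>i<t. \<l> (z i)))) * stop_prob t b (f \<circ> z) \<partial>seq_space Q)
        \<le> (\<integral>\<^sup>+x. stop_prob t b x \<partial>seq_space P1)"
    and \<alpha>: "0 < \<alpha>" "\<alpha> < 1" and \<beta>: "0 < \<beta>" "\<beta> < 1" and \<alpha>\<beta>: "\<alpha> + \<beta> \<le> 1"
    and err0: "prob_decide (joint_law (distr Q M f) R) \<tau> d (\<not> c) \<le> \<alpha>"
    and err1: "prob_decide (joint_law P1 R) \<tau> d c \<le> \<beta>"
    and fin: "expected_time (joint_law (distr Q M f) R) \<tau> \<noteq> \<infinity>"
  shows "kl \<alpha> (1 - \<beta>) \<le> enn2real (expected_time (joint_law (distr Q M f) R) \<tau>) * (\<integral>z. \<l> z \<partial>Q)"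
proof -

  \<comment> \<open>The test on the sample space of the increments\<close>
  define W where "W = seq_space Q \<Otimes>\<^sub>M R"
  define e where "e = expected_time (joint_law (distr Q M f) R) \<tau>"
  define T where "T w = \<tau> (f \<circ> fst w, snd w)" for w
  define \<delta> where "\<delta> w = d (f \<circ> fst w, snd w)" for w
  define C where "C i = {w \<in> space W. enat i < T w}" for i
  define E where "E t b = {w \<in> space W. T w = enat t \<and> \<delta> w = b}" for t b
  define S where "S t z = (\<Sum>i<t. \<l> (z i))" for t and z :: "nat \<Rightarrow> 'z"
  interpret Q: prob_space Q by fact
  interpret QQ: prob_space "seq_space Q" by (rule prob_space_PiM[OF Q])
  interpret pp: pair_prob_space "seq_space Q" R ..
  interpret W: prob_space W unfolding W_def by (rule pp.prob_space_axioms)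
  note map = measurable_comp_seq_space_pair[OF f, of R, folded W_def]
  have lm: "\<l> \<in> borel_measurable Q" using l by simp

  have E_eq: "E t b = (\<lambda>(z, u). (f \<circ> z, u)) -` stop_event t b \<inter> space W" for t b
    using measurable_space[OF map] unfolding E_def T_def \<delta>_def stop_event_def by (auto simp: case_prod_beta')
  have E: "E t b \<in> sets W" for t b
    unfolding E_eq by (rule measurable_sets[OF map sets_stop_event])
  have T_cases: "T w = \<infinity> \<or> (\<exists>t. w \<in> E t (\<delta> w))" if "w \<in> space W" for w
    using that by (cases "T w") (auto simp: E_def)

  \<comment> \<open>Wald's identity for the stopped sum\<close>
  note wald' = wald[OF Q f, folded W_def, folded T_def, folded C_def, folded e_def]
  have CT: "(\<Sum>i. indicator (C i) w * h i) = (\<Sum>i<t. h i)" if "w \<in> E t b" for w t b and h :: "nat \<Rightarrow> ennreal"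
  proof -
    have "(\<Sum>i. indicator (C i) w * h i) = (\<Sum>i<t. indicator (C i) w * h i)"
      using that by (intro suminf_finite) (auto simp: C_def E_def)
    then show ?thesis using that by (simp add: C_def E_def lessThan_def)
  qed

  \<comment> \<open>With increment 1 the stopped sum is the stopping time itself, so its finite mean
    shows that the test stops almost surely under the first law.\<close>
  have ATfin: "AE w in W. T w \<noteq> \<infinity>"
  proof -
    have const: "(\<lambda>_. 1 :: ennreal) \<in> borel_measurable Q"
      by simp
    have "(\<integral>\<^sup>+w. (\<Sum>i. indicator (C i) w * 1) \<partial>W) = e"
      using wald'(3)[OF const] by (simp add: Q.emeasure_space_1)
    then have "(\<integral>\<^sup>+w. (\<Sum>i. indicator (C i) w * 1) \<partial>W) \<noteq> \<infinity>"
      using fin unfolding e_def by (simp only: simp_thms)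
    then have "AE w in W. (\<Sum>i. indicator (C i) w * 1 :: ennreal) \<noteq> \<infinity>"
      by (rule nn_integral_PInf_AE[OF wald'(2)[OF const]])
    then show ?thesis
    proof (rule AE_mp, intro AE_I2 impI notI)
      fix w assume w: "w \<in> space W" "T w = \<infinity>"
        and ne: "(\<Sum>i. indicator (C i) w * 1 :: ennreal) \<noteq> \<infinity>"
      have "(\<Sum>i. indicator (C i) w * 1 :: ennreal) = ennreal_of_enat (T w)"
        unfolding ennreal_of_enat_eq_suminf C_def using w by (simp add: indicator_def)
      then show False using ne w by simp
    qed
  qed

  \<comment> \<open>\<open>ennreal\<close> sends negative reals to 0, so \<open>Lp\<close> and
    \<open>Lm\<close> are the stopped sums of the positive and negative parts of the increment. Both
    have finite mean, hence \<open>L\<close> is integrable.\<close>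
  define Lp where "Lp w = (\<Sum>i. indicator (C i) w * ennreal (\<l> (fst w i)))" for w
  define Lm where "Lm w = (\<Sum>i. indicator (C i) w * ennreal (- \<l> (fst w i)))" for w
  define L where "L w = enn2real (Lp w) - enn2real (Lm w)" for w
  have lpm: "(\<lambda>z. ennreal (\<l> z)) \<in> borel_measurable Q" "(\<lambda>z. ennreal (- \<l> z)) \<in> borel_measurable Q"
    by (intro measurable_compose[OF _ measurable_ennreal] borel_measurable_uminus lm)+
  have fl: "(\<integral>\<^sup>+z. ennreal (\<l> z) \<partial>Q) \<noteq> \<infinity>" "(\<integral>\<^sup>+z. ennreal (- \<l> z) \<partial>Q) \<noteq> \<infinity>"
    using l unfolding real_integrable_def by blast+
  have Lp: "Lp \<in> borel_measurable W" "(\<integral>\<^sup>+w. Lp w \<partial>W) = e * (\<integral>\<^sup>+z. ennreal (\<l> z) \<partial>Q)"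
    unfolding Lp_def by (rule wald'(2,3)[OF lpm(1)])+
  have Lm: "Lm \<in> borel_measurable W" "(\<integral>\<^sup>+w. Lm w \<partial>W) = e * (\<integral>\<^sup>+z. ennreal (- \<l> z) \<partial>Q)"
    unfolding Lm_def by (rule wald'(2,3)[OF lpm(2)])+
  have fLp: "(\<integral>\<^sup>+w. Lp w \<partial>W) \<noteq> \<infinity>" and fLm: "(\<integral>\<^sup>+w. Lm w \<partial>W) \<noteq> \<infinity>"
    using fin fl unfolding Lp(2) Lm(2) e_def[symmetric] infinity_ennreal_def ennreal_mult_eq_top_iff by blast+
  note iLp = integral_enn2real[OF Lp(1) fLp] and iLm = integral_enn2real[OF Lm(1) fLm]
  have iL: "integrable W L"
    unfolding L_def using iLp(1) iLm(1) by (rule Bochner_Integration.integrable_diff)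
  have intL: "(\<integral>w. L w \<partial>W) = enn2real e * (\<integral>z. \<l> z \<partial>Q)"
    unfolding L_def Bochner_Integration.integral_diff[OF iLp(1) iLm(1)] iLp(2) iLm(2) Lp(2) Lm(2)
      real_lebesgue_integral_def[OF l] by (simp add: enn2real_mult algebra_simps)
  have LE: "L w = S t (fst w)" if "w \<in> E t b" for w t b
  proof -
    have part: "enn2real (\<Sum>i<t. ennreal (h i)) = (\<Sum>i<t. max 0 (h i))" for h
    proof -
      have "enn2real (ennreal x) = max 0 x" for x
        by (cases "0 \<le> x") (simp_all add: ennreal_neg)
      then show ?thesis by (simp add: enn2real_sum)
    qed
    have "max 0 x - max 0 (- x) = x" for x :: real
      by simp
    then show ?thesis
      unfolding L_def Lp_def Lm_def CT[OF that] S_def part by (simp only: sum_subtractf[symmetric])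
  qed

  \<comment> \<open>\<open>G\<close> is the log-likelihood ratio of the decision in the extremal case where both error bounds
    are attained. The Donsker--Varadhan bound with this \<open>G\<close> gives exactly \<open>kl\<close>.\<close>
  define a where "a = ln ((1 - \<alpha>) / \<beta>)"
  define a' where "a' = ln (\<alpha> / (1 - \<beta>))"
  define A where "A = (\<Union>t. E t c)"
  define G where "G w = (if w \<in> A then a else a')" for w
  have A: "A \<in> sets W" unfolding A_def using E by auto
  have Gm: "G \<in> borel_measurable W"
    unfolding G_def using A by (intro measurable_If_set) auto
  \<comment> \<open>\<open>X b\<close> is \<open>exp (- L)\<close> restricted to stopping with
    decision \<open>b\<close>. Splitting it over the stopping times allows \<open>change\<close> to
    be applied to one \<open>t\<close> at a time.\<close>
  define X where "X b w = (\<Sum>t. ennreal (exp (- S t (fst w))) * indicator (E t b) w)" for b w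
  have XE: "X b w = (if b = b' then ennreal (exp (- L w)) else 0)" if "w \<in> E t b'" for b w t b'
  proof -
    have "X b w = (\<Sum>s\<in>{t}. ennreal (exp (- S s (fst w))) * indicator (E s b) w)"
      unfolding X_def using that by (intro suminf_finite) (auto simp: E_def)
    moreover have "w \<in> E t b \<longleftrightarrow> b = b'"
      using that unfolding E_def by blast
    moreover have "(\<Sum>s\<in>{t}. h s) = h t" for h :: "nat \<Rightarrow> ennreal"
      by simp
    ultimately show ?thesis
      unfolding LE[OF that] by (cases "b = b'") (simp_all only: indicator_simps mult_1_right mult_zero_right if_True if_False
          refl simp_thms)
  qed

  \<comment> \<open>Comparison with the second law\<close>
  define p1 where "p1 b = prob_decide (joint_law P1 R) \<tau> d b" for b
  interpret J1: prob_space "joint_law P1 R"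
  proof -
    interpret P1: prob_space "seq_space P1" by (rule prob_space_PiM[OF P1(1)])
    interpret pair_prob_space "seq_space P1" R ..
    show "prob_space (joint_law P1 R)" unfolding joint_law_def by (rule prob_space_axioms)
  qed
  have Sm: "(\<lambda>z. ennreal (exp (- S t z))) \<in> borel_measurable (seq_space Q)" for t
  proof -
    have "(\<lambda>z. \<l> (z i)) \<in> borel_measurable (seq_space Q)" for i
      by (rule measurable_compose[where N = Q, OF _ lm]) simp
    then show ?thesis unfolding S_def by measurable
  qed
  have Sm': "(\<lambda>w. ennreal (exp (- S t (fst w)))) \<in> borel_measurable W" for t
    unfolding W_def by (rule measurable_compose[OF measurable_fst Sm])
  have Xm': "(\<lambda>w. ennreal (exp (- S t (fst w))) * indicator (E t b) w) \<in> borel_measurable W" for t b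
    by (intro borel_measurable_times_ennreal Sm' borel_measurable_indicator E)
  then have Xm: "X b \<in> borel_measurable W" for b
    unfolding X_def by (rule borel_measurable_suminf_order)
  have X_le: "(\<integral>\<^sup>+w. X b w \<partial>W) \<le> ennreal (p1 b)" for b
  proof -
    have "(\<integral>\<^sup>+w. X b w \<partial>W) = (\<Sum>t. \<integral>\<^sup>+w. ennreal (exp (- S t (fst w))) * indicator (E t b) w \<partial>W)"
      unfolding X_def by (rule nn_integral_suminf[OF Xm'])
    also have "\<dots> \<le> (\<Sum>t. \<integral>\<^sup>+x. stop_prob t b x \<partial>seq_space P1)"
    proof (rule suminf_le)
      fix t
      have "(\<integral>\<^sup>+w. ennreal (exp (- S t (fst w))) * indicator (E t b) w \<partial>W)
        = (\<integral>\<^sup>+z. (\<integral>\<^sup>+u. ennreal (exp (- S t z)) * indicator (E t b) (z, u) \<partial>R) \<partial>seq_space Q)"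
        unfolding W_def by (subst R.nn_integral_fst[OF Xm'[unfolded W_def], symmetric]) simp
      also have "\<dots> = (\<integral>\<^sup>+z. ennreal (exp (- S t z)) * stop_prob t b (f \<circ> z) \<partial>seq_space Q)"
      proof (rule nn_integral_cong)
        fix z assume z: "z \<in> space (seq_space Q)"
        have "(\<integral>\<^sup>+u. indicator (E t b) (z, u) \<partial>R) = (\<integral>\<^sup>+u. indicator (Pair z -` E t b) u \<partial>R)"
          by (simp add: indicator_def)
        also have "\<dots> = emeasure R (Pair z -` E t b)"
          by (rule nn_integral_indicator) (rule sets_Pair1[OF E[unfolded W_def]])
        also have "Pair z -` E t b = {u \<in> space R. \<tau> (f \<circ> z, u) = enat t \<and> d (f \<circ> z, u) = b}"
          using z by (auto simp: E_def W_def T_def \<delta>_def space_pair_measure)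
        finally have "(\<integral>\<^sup>+u. indicator (E t b) (z, u) \<partial>R) = stop_prob t b (f \<circ> z)"
          by (simp add: stop_prob_def)
        moreover have "(\<lambda>u. indicator (E t b) (z, u) :: ennreal) \<in> borel_measurable R"
          by (rule measurable_compose[OF measurable_Pair1'[OF z] borel_measurable_indicator[OF E[unfolded W_def]]])
        ultimately show "(\<integral>\<^sup>+u. ennreal (exp (- S t z)) * indicator (E t b) (z, u) \<partial>R)
          = ennreal (exp (- S t z)) * stop_prob t b (f \<circ> z)"
          by (simp add: nn_integral_cmult)
      qed
      also have "\<dots> \<le> (\<integral>\<^sup>+x. stop_prob t b x \<partial>seq_space P1)"
        using change[of t b] unfolding S_def .
      finally show "(\<integral>\<^sup>+w. ennreal (exp (- S t (fst w))) * indicator (E t b) w \<partial>W)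
        \<le> (\<integral>\<^sup>+x. stop_prob t b x \<partial>seq_space P1)" .
    qed auto
    also have "\<dots> = ennreal (p1 b)"
      unfolding p1_def prob_decide_def emeasure_decide[OF P1, symmetric] by (rule J1.emeasure_eq_measure)
    finally show ?thesis .
  qed

  \<comment> \<open>The exponential moment of \<open>G - L\<close>\<close>
  have pos: "0 < (1 - \<alpha>) / \<beta>" "0 < \<alpha> / (1 - \<beta>)" "0 \<le> p1 b" for b
    using \<alpha> \<beta> by (auto simp: p1_def prob_decide_def)
  \<comment> \<open>The left side is the mean of \<open>exp G\<close> under the second law over runs
    that stop. At \<open>p1 c = \<beta>\<close> and \<open>p1 (\<not> c) = 1 - \<beta>\<close> it
    equals \<open>(1 - \<alpha>) + \<alpha>\<close>. The other cases lie below this one because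
    \<open>\<alpha> + \<beta> \<le> 1\<close> makes the weight of \<open>c\<close> the larger
    one.\<close>
  have le1: "(1 - \<alpha>) / \<beta> * p1 c + \<alpha> / (1 - \<beta>) * p1 (\<not> c) \<le> 1"
  proof -
    define q where "q = p1 c"
    \<comment> \<open>Only an inequality: almost sure stopping is known under the first law, not
      under the second.\<close>
    have sum: "p1 (\<not> c) \<le> 1 - q"
    proof -
      have "p1 c + p1 (\<not> c) = J1.prob ((\<Union>t. stop_event t c) \<union> (\<Union>t. stop_event t (\<not> c)))"
        unfolding p1_def prob_decide_def decide_eq_UN[OF P1(2)]
        by (rule J1.finite_measure_Union[symmetric])
          (use sets_stop_event in \<open>auto simp only: sets_joint_law[OF P1(2)] intro!: sets.countable_UN\<close>,
            auto simp: stop_event_def)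
      then show ?thesis using J1.prob_le_1 unfolding q_def by (metis le_diff_eq add.commute)
    qed
    have ge: "\<alpha> / (1 - \<beta>) \<le> 1" "1 \<le> (1 - \<alpha>) / \<beta>"
      using \<alpha> \<beta> \<alpha>\<beta> by (simp_all add: field_simps)
    have "(1 - \<alpha>) / \<beta> * q + \<alpha> / (1 - \<beta>) * p1 (\<not> c) \<le> (1 - \<alpha>) / \<beta> * q + \<alpha> / (1 - \<beta>) * (1 - q)"
      using sum pos by (intro add_left_mono mult_left_mono) auto
    also have "\<dots> = \<alpha> / (1 - \<beta>) + ((1 - \<alpha>) / \<beta> - \<alpha> / (1 - \<beta>)) * q"
      by (simp only: algebra_simps)
    also have "\<dots> \<le> \<alpha> / (1 - \<beta>) + ((1 - \<alpha>) / \<beta> - \<alpha> / (1 - \<beta>)) * \<beta>"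
      using ge err1 by (intro add_left_mono mult_left_mono) (auto simp: q_def p1_def)
    also have "\<dots> = 1"
    proof -
      have "(1 - \<alpha>) / \<beta> * \<beta> = 1 - \<alpha>" "\<alpha> / (1 - \<beta>) * (1 - \<beta>) = \<alpha>"
        using \<beta> by auto
      moreover have "k' + (k - k') * \<beta> = k * \<beta> + k' * (1 - \<beta>)" for k k' :: real
        by (simp add: algebra_simps)
      ultimately show ?thesis by simp
    qed
    finally show ?thesis by (simp add: q_def)
  qed
  define Y where "Y w = exp (G w - L w)" for w
  have Ym: "Y \<in> borel_measurable W"
    unfolding Y_def using Gm iL by measurable
  have Y: "(\<integral>\<^sup>+w. ennreal (Y w) \<partial>W) \<le> 1"
  proof -
    \<comment> \<open>Where the test stops, exactly one of the two \<open>X\<close> terms is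
      nonzero, and its coefficient is \<open>exp a\<close> or \<open>exp a'\<close>.\<close>
    have "AE w in W. ennreal (Y w) = ennreal ((1 - \<alpha>) / \<beta>) * X c w + ennreal (\<alpha> / (1 - \<beta>)) * X (\<not> c) w"
      using ATfin
    proof (rule AE_mp, intro AE_I2 impI)
      fix w assume "w \<in> space W" "T w \<noteq> \<infinity>"
      then obtain t where w: "w \<in> E t (\<delta> w)" using T_cases[of w] by auto
      then have "w \<in> A \<longleftrightarrow> \<delta> w = c" by (auto simp: A_def E_def)
      then show "ennreal (Y w) = ennreal ((1 - \<alpha>) / \<beta>) * X c w + ennreal (\<alpha> / (1 - \<beta>)) * X (\<not> c) w"
        unfolding XE[OF w] using pos
        by (auto simp: Y_def G_def a_def a'_def exp_diff exp_minus ennreal_mult[symmetric] divide_inverse)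
    qed
    then have "(\<integral>\<^sup>+w. ennreal (Y w) \<partial>W)
      = ennreal ((1 - \<alpha>) / \<beta>) * (\<integral>\<^sup>+w. X c w \<partial>W) + ennreal (\<alpha> / (1 - \<beta>)) * (\<integral>\<^sup>+w. X (\<not> c) w \<partial>W)"
      using Xm by (subst nn_integral_cong_AE) (auto simp: nn_integral_add nn_integral_cmult)
    also have "\<dots> \<le> ennreal ((1 - \<alpha>) / \<beta>) * ennreal (p1 c) + ennreal (\<alpha> / (1 - \<beta>)) * ennreal (p1 (\<not> c))"
      by (intro add_mono mult_left_mono X_le) auto
    also have "\<dots> = ennreal ((1 - \<alpha>) / \<beta> * p1 c + \<alpha> / (1 - \<beta>) * p1 (\<not> c))"
      using pos by (simp only: ennreal_mult[symmetric] ennreal_plus[symmetric] less_imp_le mult_nonneg_nonneg)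
    also have "\<dots> \<le> 1" using le1 by simp
    finally show ?thesis .
  qed
  have iY: "integrable W Y"
    using Y by (intro integrableI_nonneg Ym) (auto simp: Y_def less_top[symmetric] top_unique)
  have intY: "(\<integral>w. Y w \<partial>W) \<le> 1"
    by (rule integral_real_bounded) (use Y in \<open>auto simp: Y_def\<close>)
  have iG: "integrable W G"
    by (rule W.integrable_const_bound[where B = "max \<bar>a\<bar> \<bar>a'\<bar>", OF _ Gm]) (auto simp: G_def)
  have "(\<integral>w. 1 + (G w - L w) \<partial>W) \<le> (\<integral>w. Y w \<partial>W)"
    unfolding Y_def using iY[unfolded Y_def] iG iL
    by (intro integral_mono) (auto simp: exp_ge_add_one_self)
  then have GL: "(\<integral>w. G w \<partial>W) \<le> (\<integral>w. L w \<partial>W)"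
    using intY iG iL by (simp add: W.prob_space)

  \<comment> \<open>The mean of \<open>G\<close> under the first law\<close>
  have "(\<integral>w. G w \<partial>W) = a * measure W A + a' * (1 - measure W A)"
  proof -
    have "(\<integral>w. G w \<partial>W) = (\<integral>w. a * indicator A w + a' * indicator (space W - A) w \<partial>W)"
      by (rule Bochner_Integration.integral_cong) (auto simp: G_def)
    also have "\<dots> = a * measure W A + a' * measure W (space W - A)"
    proof -
      have ind: "integrable W (\<lambda>w. k * indicator B w)" "(\<integral>w. k * indicator B w \<partial>W) = k * measure W B"
        if "B \<in> sets W" for B and k :: real
        using that by (simp_all add: W.emeasure_eq_measure)
      show ?thesis
        using ind A by (subst Bochner_Integration.integral_add) auto
    qed
    finally show ?thesis using W.prob_compl[OF A] by simp
  qed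
  also have "\<dots> = a' + (a - a') * measure W A"
    by (simp add: algebra_simps)
  \<comment> \<open>The expression grows with the probability of \<open>A\<close> because
    \<open>a' \<le> a\<close>. By almost sure stopping the complement of \<open>A\<close> is the
    wrong decision up to a null set, of probability at most \<open>\<alpha>\<close>. At probability
    \<open>1 - \<alpha>\<close> the value is \<open>kl \<alpha> (1 - \<beta>)\<close>.\<close>
  also have "a' + (a - a') * measure W A \<ge> a' + (a - a') * (1 - \<alpha>)"
  proof (intro add_left_mono mult_left_mono)
    define B where "B = (\<Union>t. E t (\<not> c))"
    have B: "B \<in> sets W" unfolding B_def using E by auto
    have P0: "sets (distr Q M f) = sets M" by simp
    have "B = (\<lambda>(z, u). (f \<circ> z, u)) -` (\<Union>t. stop_event t (\<not> c)) \<inter> space W"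
      unfolding B_def E_eq by blast
    then have "measure W B = prob_decide (joint_law (distr Q M f) R) \<tau> d (\<not> c)"
      unfolding prob_decide_def decide_eq_UN[OF P0]
      unfolding joint_law_def distr_seq_space_pair[OF Q R.prob_space_axioms f, symmetric] W_def[symmetric]
      using sets_stop_event by (subst measure_distr[OF map]) auto
    moreover have "measure W (space W - A) \<le> measure W B"
    proof (rule W.finite_measure_mono_AE[OF _ B])
      show "AE w in W. w \<in> space W - A \<longrightarrow> w \<in> B"
        using ATfin
      proof (rule AE_mp, intro AE_I2 impI)
        fix w assume "w \<in> space W" "T w \<noteq> \<infinity>" "w \<in> space W - A"
        moreover from this obtain t where w: "w \<in> E t (\<delta> w)" using T_cases[of w] by auto
        ultimately show "w \<in> B" by (cases "\<delta> w = c") (auto simp: A_def B_def)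
      qed
    qed
    ultimately show "1 - \<alpha> \<le> measure W A"
      using W.prob_compl[OF A] err0 by simp
    have "\<alpha> / (1 - \<beta>) \<le> (1 - \<alpha>) / \<beta>"
    proof (rule order_trans)
      show "\<alpha> / (1 - \<beta>) \<le> 1" "1 \<le> (1 - \<alpha>) / \<beta>"
        using \<alpha> \<beta> \<alpha>\<beta> by (simp_all add: field_simps)
    qed
    then show "0 \<le> a - a'"
      unfolding a_def a'_def using pos by simp
  qed
  finally have "kl \<alpha> (1 - \<beta>) \<le> (\<integral>w. G w \<partial>W)"
    by (simp add: kl_def a_def a'_def algebra_simps)
  also note GL
  also note intL
  finally show ?thesis unfolding e_def .
qed

end

section \<open>The likelihood-ratio bound\<close>

text \<open>On rectangles the indicator and the density both factor over the coordinates. Finiteness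
  of \<open>J\<close> is essential: two infinite i.i.d. sequences with different marginals have
  mutually singular laws.\<close>

lemma density_PiM:
  assumes J: "finite J" and N: "prob_space N" and r: "r \<in> borel_measurable N"
    and P: "prob_space (density N r)"
  shows "(\<Pi>\<^sub>M i\<in>J. density N r) = density (\<Pi>\<^sub>M i\<in>J. N) (\<lambda>x. \<Prod>i\<in>J. r (x i))"
proof -
  interpret N: prob_space N by fact
  interpret P: prob_space "density N r" by fact
  interpret NN: product_sigma_finite "\<lambda>_. N" ..
  interpret PP: product_sigma_finite "\<lambda>_. density N r" ..
  have m: "(\<lambda>x. \<Prod>i\<in>J. r (x i)) \<in> borel_measurable (\<Pi>\<^sub>M i\<in>J. N)"
    by (intro borel_measurable_prod_ennreal measurable_compose[where N = N, OF _ r] measurable_component_singleton)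
  show ?thesis
  proof (rule PP.PiM_eqI[OF J, symmetric])
    show "sets (density (\<Pi>\<^sub>M i\<in>J. N) (\<lambda>x. \<Prod>i\<in>J. r (x i))) = sets (\<Pi>\<^sub>M i\<in>J. density N r)"
      by (simp cong: sets_PiM_cong)
  next
    fix A assume "\<And>i. i \<in> J \<Longrightarrow> A i \<in> sets (density N r)"
    then have A: "\<And>i. i \<in> J \<Longrightarrow> A i \<in> sets N" by simp
    have "emeasure (density (\<Pi>\<^sub>M i\<in>J. N) (\<lambda>x. \<Prod>i\<in>J. r (x i))) (Pi\<^sub>E J A)
        = (\<integral>\<^sup>+x. (\<Prod>i\<in>J. r (x i)) * indicator (Pi\<^sub>E J A) x \<partial>(\<Pi>\<^sub>M i\<in>J. N))"
      using J A by (intro emeasure_density m sets_PiM_I_finite) auto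
    also have "\<dots> = (\<integral>\<^sup>+x. (\<Prod>i\<in>J. r (x i) * indicator (A i) (x i)) \<partial>(\<Pi>\<^sub>M i\<in>J. N))"
    proof (rule nn_integral_cong)
      fix x assume "x \<in> space (\<Pi>\<^sub>M i\<in>J. N)"
      then have x: "x \<in> extensional J" by (simp add: space_PiM PiE_iff)
      have "(\<Prod>i\<in>J. indicator (A i) (x i) :: ennreal) = indicator (Pi\<^sub>E J A) x"
      proof (cases "x \<in> Pi\<^sub>E J A")
        case False
        then obtain i where "i \<in> J" "x i \<notin> A i" using x by (auto simp: PiE_iff)
        then have "(\<Prod>i\<in>J. indicator (A i) (x i) :: ennreal) = 0"
          by (intro prod_zero[OF J] bexI[of _ i]) simp_all
        then show ?thesis using False by simp
      qed (auto simp: PiE_iff)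
      then show "(\<Prod>i\<in>J. r (x i)) * indicator (Pi\<^sub>E J A) x = (\<Prod>i\<in>J. r (x i) * indicator (A i) (x i))"
        by (simp add: prod.distrib)
    qed
    also have "\<dots> = (\<Prod>i\<in>J. \<integral>\<^sup>+x. r x * indicator (A i) x \<partial>N)"
      using A r by (intro NN.product_nn_integral_prod J) auto
    also have "\<dots> = (\<Prod>i\<in>J. emeasure (density N r) (A i))"
      using A r by (intro prod.cong refl) (simp add: emeasure_density)
    finally show "emeasure (density (\<Pi>\<^sub>M i\<in>J. N) (\<lambda>x. \<Prod>i\<in>J. r (x i))) (Pi\<^sub>E J A)
        = (\<Prod>i\<in>J. emeasure (density N r) (A i))" .
  qed
qed

text \<open>A function of the first \<open>t\<close> coordinates is integrated against a
  finite-dimensional marginal, where the likelihood ratio is a product. The change of measure is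
  thus made at each fixed time, never on the whole sequence space.\<close>

lemma nn_integral_seq_space_density:
  fixes N :: "'a measure" and \<phi> :: "(nat \<Rightarrow> 'a) \<Rightarrow> ennreal"
  assumes N: "prob_space N" and r: "r \<in> borel_measurable N" and P: "prob_space (density N r)"
    and \<phi>: "\<phi> \<in> borel_measurable (seq_space N)"
    and cong: "\<And>x x'. x \<in> space (seq_space N) \<Longrightarrow> x' \<in> space (seq_space N) \<Longrightarrow>
      (\<And>i. i < t \<Longrightarrow> x i = x' i) \<Longrightarrow> \<phi> x = \<phi> x'"
  shows "(\<integral>\<^sup>+x. \<phi> x \<partial>seq_space (density N r)) = (\<integral>\<^sup>+x. (\<Prod>i<t. r (x i)) * \<phi> x \<partial>seq_space N)"
proof -
  interpret N: prob_space N by fact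
  obtain x0 where x0: "x0 \<in> space N" using N.not_empty by blast
  \<comment> \<open>Padding with the arbitrary point \<open>x0\<close> makes \<open>\<phi>\<close> a
    function on the finite product; by \<open>cong\<close> the choice of padding does not affect its
    value.\<close>
  define ext where "ext y i = (if i < t then y i else x0)" for y :: "nat \<Rightarrow> 'a" and i
  let ?J = "{..<t}"
  have extm: "ext \<in> (\<Pi>\<^sub>M i\<in>?J. N) \<rightarrow>\<^sub>M seq_space N"
  proof -
    have "(\<lambda>y i. ext y i) \<in> (\<Pi>\<^sub>M i\<in>?J. N) \<rightarrow>\<^sub>M seq_space N"
    proof (rule measurable_PiM_single')
      fix i show "(\<lambda>y. ext y i) \<in> (\<Pi>\<^sub>M i\<in>?J. N) \<rightarrow>\<^sub>M N"
        using x0 by (cases "i < t") (auto simp: ext_def intro: measurable_component_singleton)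
    qed (use x0 in \<open>auto simp: ext_def space_PiM PiE_iff\<close>)
    then show ?thesis by simp
  qed
  have \<psi>: "(\<lambda>y. \<phi> (ext y)) \<in> borel_measurable (\<Pi>\<^sub>M i\<in>?J. N)"
    by (rule measurable_compose[OF extm \<phi>])
  have \<phi>_eq: "\<phi> x = \<phi> (ext (restrict x ?J))" if "x \<in> space (seq_space N)" for x
    using that x0 by (intro cong) (auto simp: ext_def space_PiM PiE_iff)
  \<comment> \<open>Stated for a general law \<open>P'\<close>, since it is used once to pass to the
    finite marginal of the density and once to return from that of \<open>N\<close>.\<close>
  have res: "(\<integral>\<^sup>+x. h (restrict x ?J) \<partial>seq_space P') = (\<integral>\<^sup>+y. h y \<partial>(\<Pi>\<^sub>M i\<in>?J. P'))"
    if P': "prob_space P'" "sets P' = sets N" and h: "h \<in> borel_measurable (\<Pi>\<^sub>M i\<in>?J. N)"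
    for P' :: "'a measure" and h :: "(nat \<Rightarrow> 'a) \<Rightarrow> ennreal"
  proof -
    interpret P': prob_space P' by fact
    interpret PP: product_prob_space "\<lambda>_::nat. P'" UNIV ..
    have "(\<integral>\<^sup>+y. h y \<partial>(\<Pi>\<^sub>M i\<in>?J. P')) = (\<integral>\<^sup>+y. h y \<partial>distr (seq_space P') (\<Pi>\<^sub>M i\<in>?J. P') (\<lambda>x. restrict x ?J))"
      by (subst PP.distr_PiM_restrict_finite) auto
    also have "\<dots> = (\<integral>\<^sup>+x. h (restrict x ?J) \<partial>seq_space P')"
    proof (rule nn_integral_distr)
      show "(\<lambda>x. restrict x ?J) \<in> seq_space P' \<rightarrow>\<^sub>M (\<Pi>\<^sub>M i\<in>?J. P')"
        by (rule measurable_restrict_subset) simp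
      have "sets (\<Pi>\<^sub>M i\<in>?J. P') = sets (\<Pi>\<^sub>M i\<in>?J. N)"
        using P'(2) by (intro sets_PiM_cong) auto
      then show "h \<in> borel_measurable (distr (seq_space P') (\<Pi>\<^sub>M i\<in>?J. P') (\<lambda>x. restrict x ?J))"
        using h by (simp cong: measurable_cong_sets)
    qed
    finally show ?thesis by simp
  qed
  have "space (seq_space (density N r)) = space (seq_space N)"
    by (simp add: space_PiM)
  then have "(\<integral>\<^sup>+x. \<phi> x \<partial>seq_space (density N r)) = (\<integral>\<^sup>+x. \<phi> (ext (restrict x ?J)) \<partial>seq_space (density N r))"
    using \<phi>_eq by (intro nn_integral_cong) simp
  also have "\<dots> = (\<integral>\<^sup>+y. \<phi> (ext y) \<partial>(\<Pi>\<^sub>M i\<in>?J. density N r))"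
    using res[OF P _ \<psi>] by simp
  also have "\<dots> = (\<integral>\<^sup>+y. (\<Prod>i<t. r (y i)) * \<phi> (ext y) \<partial>(\<Pi>\<^sub>M i\<in>?J. N))"
  proof -
    have "(\<lambda>y. \<Prod>i<t. r (y i)) \<in> borel_measurable (\<Pi>\<^sub>M i\<in>?J. N)"
      by (intro borel_measurable_prod_ennreal measurable_compose[where N = N, OF _ r] measurable_component_singleton)
    then show ?thesis
      unfolding density_PiM[OF finite_lessThan N r P] by (rule nn_integral_density[OF _ \<psi>])
  qed
  also have "\<dots> = (\<integral>\<^sup>+x. (\<Prod>i<t. r (restrict x ?J i)) * \<phi> (ext (restrict x ?J)) \<partial>seq_space N)"
  proof (rule res[OF N refl, symmetric])
    show "(\<lambda>y. (\<Prod>i<t. r (y i)) * \<phi> (ext y)) \<in> borel_measurable (\<Pi>\<^sub>M i\<in>?J. N)"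
      by (intro borel_measurable_times_ennreal \<psi> borel_measurable_prod_ennreal
          measurable_compose[where N = N, OF _ r] measurable_component_singleton)
  qed
  also have "\<dots> = (\<integral>\<^sup>+x. (\<Prod>i<t. r (x i)) * \<phi> x \<partial>seq_space N)"
    using \<phi>_eq by (intro nn_integral_cong) simp
  finally show ?thesis .
qed

context seq_test begin

text \<open>The samples are the observations themselves, \<open>f\<close> is the identity and the
  increment is the log-likelihood ratio. Finite divergence supplies absolute continuity and an
  integrable increment, whose mean is the divergence.\<close>

lemma KL_bound:
  assumes P0: "prob_space P0" "sets P0 = sets M" and P1: "prob_space P1" "sets P1 = sets M"
    and \<alpha>: "0 < \<alpha>" "\<alpha> < 1" and \<beta>: "0 < \<beta>" "\<beta> < 1" and \<alpha>\<beta>: "\<alpha> + \<beta> \<le> 1"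
    and err0: "prob_decide (joint_law P0 R) \<tau> d (\<not> c) \<le> \<alpha>"
    and err1: "prob_decide (joint_law P1 R) \<tau> d c \<le> \<beta>"
    and fin: "expected_time (joint_law P0 R) \<tau> \<noteq> \<infinity>" and KL: "KL P0 P1 \<noteq> \<infinity>"
  shows "ennreal (kl \<alpha> (1 - \<beta>)) \<le> expected_time (joint_law P0 R) \<tau> * KL P0 P1"
proof -
  interpret P0: prob_space P0 by fact
  interpret P1: prob_space P1 by fact
  \<comment> \<open>The reference measure comes first in \<open>entropy_density\<close>, so this is
    the logarithm of the density of \<open>P0\<close> with respect to \<open>P1\<close>.\<close>
  define \<l> where "\<l> = entropy_density (exp 1) P1 P0"
  have ac: "absolutely_continuous P1 P0" and int: "integrable P0 \<l>" and KL_eq: "KL P0 P1 = ennreal (\<integral>x. \<l> x \<partial>P0)"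
    using KL by (auto simp: KL_def \<l>_def KL_divergence_def split: if_splits)
  have s: "sets P0 = sets P1" using P0 P1 by simp
  define r where "r x = enn2real (RN_deriv P1 P0 x)" for x
  have l_eq: "\<l> x = ln (r x)" for x
    by (simp add: \<l>_def entropy_density_def r_def log_def)
  have rm: "(\<lambda>x. ennreal (r x)) \<in> borel_measurable P1"
    unfolding r_def by measurable
  have P0_eq: "density P1 (\<lambda>x. ennreal (r x)) = P0"
  proof -
    have "AE x in P1. RN_deriv P1 P0 x \<noteq> \<infinity>"
      using P0.sigma_finite_measure_axioms ac s by (rule P1.RN_deriv_finite)
    then have "density P1 (\<lambda>x. ennreal (r x)) = density P1 (RN_deriv P1 P0)"
      using rm by (intro density_cong) (auto simp: r_def less_top)
    also have "\<dots> = P0" using P1.density_RN_deriv[OF ac s] .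
    finally show ?thesis .
  qed
  have id: "(\<lambda>x. x) \<in> P0 \<rightarrow>\<^sub>M M" using P0(2) by (simp add: measurable_ident_sets)
  have distr: "distr P0 M (\<lambda>x. x) = P0" using P0(2) by (simp add: distr_id2)
  have change: "(\<integral>\<^sup>+z. ennreal (exp (- (\<Sum>i<t. \<l> (z i)))) * stop_prob t b ((\<lambda>x. x) \<circ> z) \<partial>seq_space P0)
      \<le> (\<integral>\<^sup>+x. stop_prob t b x \<partial>seq_space P1)" for t b
  proof -
    have sets_eq: "sets (seq_space P1) = sets (seq_space M)"
      using P1(2) by (intro sets_PiM_cong) auto
    have sp: "space (seq_space P1) = space (seq_space M)"
      by (rule sets_eq_imp_space_eq[OF sets_eq])
    have lm: "\<l> \<in> borel_measurable P1" unfolding \<l>_def by measurable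
    have lm': "(\<lambda>z. \<l> (z i)) \<in> borel_measurable (seq_space P1)" for i
      by (rule measurable_compose[where N = P1, OF _ lm]) simp
    have sm: "stop_prob t b \<in> borel_measurable (seq_space P1)"
      using measurable_stop_prob by (simp only: measurable_cong_sets[OF sets_eq refl])
    have m: "(\<lambda>z. ennreal (exp (- (\<Sum>i<t. \<l> (z i)))) * stop_prob t b z) \<in> borel_measurable (seq_space P1)"
      by (intro borel_measurable_times_ennreal sm measurable_compose[OF _ measurable_ennreal]
          borel_measurable_exp borel_measurable_uminus borel_measurable_sum lm'
          measurable_compose[where g = exp and N = borel])
    have "(\<integral>\<^sup>+z. ennreal (exp (- (\<Sum>i<t. \<l> (z i)))) * stop_prob t b z \<partial>seq_space (density P1 (\<lambda>x. ennreal (r x))))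
      = (\<integral>\<^sup>+z. (\<Prod>i<t. ennreal (r (z i))) * (ennreal (exp (- (\<Sum>i<t. \<l> (z i)))) * stop_prob t b z) \<partial>seq_space P1)"
    proof (rule nn_integral_seq_space_density[OF P1(1) rm _ m])
      show "prob_space (density P1 (\<lambda>x. ennreal (r x)))" using P0 by (simp only: P0_eq)
      fix x x' assume *: "x \<in> space (seq_space P1)" "x' \<in> space (seq_space P1)" "\<And>i. i < t \<Longrightarrow> x i = x' i"
      have "stop_prob t b x = stop_prob t b x'"
        by (rule stop_prob_cong) (use * in \<open>auto simp only: sp\<close>)
      then show "ennreal (exp (- (\<Sum>i<t. \<l> (x i)))) * stop_prob t b x
          = ennreal (exp (- (\<Sum>i<t. \<l> (x' i)))) * stop_prob t b x'"
        using *(3) by simp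
    qed
    also have "\<dots> \<le> (\<integral>\<^sup>+x. stop_prob t b x \<partial>seq_space P1)"
    proof (rule nn_integral_mono)
      fix z :: "nat \<Rightarrow> 'a"
      have nn: "0 \<le> r x" for x by (simp add: r_def)
      \<comment> \<open>Equality holds where \<open>r x\<close> is positive. Where
        \<open>r x = 0\<close> the left side is 0 whatever \<open>ln 0\<close> returns; the mass of
        \<open>P1\<close> lost there is why the comparison is an inequality.\<close>
      have "r x * exp (- \<l> x) \<le> 1" for x
        using nn[of x] by (cases "r x = 0") (auto simp: l_eq exp_minus)
      then have "(\<Prod>i<t. r (z i) * exp (- \<l> (z i))) \<le> 1"
        using nn by (intro prod_le_1) auto
      moreover have "(\<Prod>i<t. ennreal (r (z i))) * ennreal (exp (- (\<Sum>i<t. \<l> (z i))))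
          = ennreal (\<Prod>i<t. r (z i) * exp (- \<l> (z i)))"
        using nn by (simp add: prod_ennreal ennreal_mult[symmetric] prod_nonneg sum_negf[symmetric]
            exp_sum prod.distrib)
      ultimately have "(\<Prod>i<t. ennreal (r (z i))) * ennreal (exp (- (\<Sum>i<t. \<l> (z i)))) \<le> 1"
        by simp
      from mult_right_mono[OF this, of "stop_prob t b z"]
      show "(\<Prod>i<t. ennreal (r (z i))) * (ennreal (exp (- (\<Sum>i<t. \<l> (z i)))) * stop_prob t b z) \<le> stop_prob t b z"
        by (simp add: mult.assoc)
    qed
    finally show ?thesis by (simp add: P0_eq comp_def)
  qed
  have "kl \<alpha> (1 - \<beta>) \<le> enn2real (expected_time (joint_law (distr P0 M (\<lambda>x. x)) R) \<tau>) * (\<integral>z. \<l> z \<partial>P0)"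
    by (rule change_of_measure_bound[OF P0(1) id int P1 change \<alpha> \<beta> \<alpha>\<beta> _ err1])
      (simp_all only: distr err0 fin simp_thms)
  then have "ennreal (kl \<alpha> (1 - \<beta>)) \<le> ennreal (enn2real (expected_time (joint_law P0 R) \<tau>) * (\<integral>z. \<l> z \<partial>P0))"
    unfolding distr by (rule ennreal_leI)
  also have "\<dots> = expected_time (joint_law P0 R) \<tau> * KL P0 P1"
    using fin by (simp add: ennreal_mult' KL_eq less_top[symmetric])
  finally show ?thesis .
qed

end

section \<open>The privacy bound\<close>

lemma TV_commute: "sets P = sets N \<Longrightarrow> TV P N = TV N P"
  unfolding TV_def by (simp add: abs_minus_commute)

lemma measure_diff_le_TV:
  assumes P: "prob_space P" and N: "prob_space N" and A: "A \<in> sets P"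
  shows "measure P A - measure N A \<le> TV P N"
proof -
  interpret P: prob_space P by fact
  interpret N: prob_space N by fact
  have "\<bar>measure P A - measure N A\<bar> \<le> TV P N"
    unfolding TV_def
  proof (rule cSUP_upper[OF A])
    show "bdd_above ((\<lambda>A. \<bar>measure P A - measure N A\<bar>) ` sets P)"
    proof (rule bdd_aboveI2[of _ _ 1])
      fix A
      have "0 \<le> measure P A" "measure P A \<le> 1" "0 \<le> measure N A" "measure N A \<le> 1"
        by auto
      then show "\<bar>measure P A - measure N A\<bar> \<le> 1" by linarith
    qed
  qed
  then show ?thesis by linarith
qed

lemma emeasure_uniform_unit:
  assumes "0 \<le> r" "r \<le> (1::real)"
  shows "emeasure (uniform_measure lborel {0..1}) {..r} = ennreal r"
    and "emeasure (uniform_measure lborel {0..1}) {r<..} = ennreal (1 - r)"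
proof -
  have "{0..1} \<inter> {..r} = {0..r}" "{0..1} \<inter> {r<..} = {r<..1}" using assms by auto
  then show "emeasure (uniform_measure lborel {0..1}) {..r} = ennreal r"
    "emeasure (uniform_measure lborel {0..1}) {r<..} = ennreal (1 - r)"
    using assms by (simp_all add: emeasure_uniform_measure divide_ennreal_def)
qed

lemma ennreal_mult_divide_cancel: "a * (b / a) = b" if "a \<noteq> 0" "a \<noteq> \<infinity>" for a b :: ennreal
  using that mult_divide_eq_ennreal[of a b] by (simp add: ennreal_times_divide mult.commute)

text \<open>
  The set \<open>F\<close> flags the points where the two coordinates may differ; the set where they do differ
  need not be measurable, since the diagonal of \<open>\<mu> \<Otimes>\<^sub>M \<mu>\<close> need not be.
\<close>

lemma maximal_coupling:
  fixes \<mu> :: "'a measure" and p0 p1 :: "'a \<Rightarrow> ennreal"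
  assumes p0 [measurable]: "p0 \<in> borel_measurable \<mu>" and p1 [measurable]: "p1 \<in> borel_measurable \<mu>"
    and P0: "prob_space (density \<mu> p0)" and P1: "prob_space (density \<mu> p1)"
    and ne: "density \<mu> p0 \<noteq> density \<mu> p1"
  obtains Q :: "(('a \<times> real) \<times> 'a) measure" and g F
  where "prob_space Q" "fst \<circ> fst \<in> Q \<rightarrow>\<^sub>M \<mu>" "g \<in> Q \<rightarrow>\<^sub>M \<mu>" "F \<in> sets Q"
    "distr Q \<mu> (fst \<circ> fst) = density \<mu> p0" "distr Q \<mu> g = density \<mu> p1"
    "\<And>z. z \<in> space Q \<Longrightarrow> z \<notin> F \<Longrightarrow> (fst \<circ> fst) z = g z"
    "measure Q F \<le> TV (density \<mu> p0) (density \<mu> p1)"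
proof -

  \<comment> \<open>Overlap and excess of the two densities\<close>
  define P0 where "P0 = density \<mu> p0"
  define P1 where "P1 = density \<mu> p1"
  interpret P0: prob_space P0 unfolding P0_def by fact
  interpret P1: prob_space P1 unfolding P1_def by fact
  define m where "m x = min (p0 x) (p1 x)" for x
  have [measurable]: "m \<in> borel_measurable \<mu>" unfolding m_def by measurable
  have m_le: "m x \<le> p0 x" "m x \<le> p1 x" for x by (simp_all add: m_def)
  have int0: "(\<integral>\<^sup>+x. p0 x \<partial>\<mu>) = 1" and int1: "(\<integral>\<^sup>+x. p1 x \<partial>\<mu>) = 1"
    using P0.emeasure_space_1 P1.emeasure_space_1
    by (simp_all add: P0_def P1_def emeasure_density cong: nn_integral_cong_simp)
  have fin0: "AE x in \<mu>. p0 x \<noteq> \<infinity>" and fin1: "AE x in \<mu>. p1 x \<noteq> \<infinity>"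
    by (rule nn_integral_PInf_AE; simp add: int0 int1)+
  have intm: "(\<integral>\<^sup>+x. m x \<partial>\<mu>) \<noteq> \<infinity>"
  proof -
    have "(\<integral>\<^sup>+x. m x \<partial>\<mu>) \<le> (\<integral>\<^sup>+x. p0 x \<partial>\<mu>)"
      by (intro nn_integral_mono) (simp add: m_def)
    then show ?thesis unfolding int0 by (auto simp: top_unique)
  qed
  \<comment> \<open>Both densities have mass 1, so their excesses over the overlap \<open>m\<close>
    have the same mass \<open>\<Delta>\<close>, which becomes the redraw probability.\<close>
  define \<Delta> where "\<Delta> = (\<integral>\<^sup>+x. p0 x - m x \<partial>\<mu>)"
  have \<Delta>0: "\<Delta> = 1 - (\<integral>\<^sup>+x. m x \<partial>\<mu>)"
    unfolding \<Delta>_def using intm by (subst nn_integral_diff) (auto simp: int0 m_le)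
  have \<Delta>1: "\<Delta> = (\<integral>\<^sup>+x. p1 x - m x \<partial>\<mu>)"
    unfolding \<Delta>0 using intm by (subst nn_integral_diff) (auto simp: int1 m_le)
  have \<Delta>le: "\<Delta> \<le> 1" unfolding \<Delta>0 by (rule diff_le_self_ennreal)
  have \<Delta>fin: "\<Delta> \<noteq> \<infinity>" using \<Delta>le by (auto simp: top_unique)
  \<comment> \<open>\<open>\<Delta>\<close> normalises the law \<open>\<Lambda>\<close> below. If it
    vanished, both densities would equal \<open>m\<close> almost everywhere, against
    \<open>ne\<close>.\<close>
  have \<Delta>ne: "\<Delta> \<noteq> 0"
  proof
    assume "\<Delta> = 0"
    then have "(\<integral>\<^sup>+x. p0 x - m x \<partial>\<mu>) = 0" "(\<integral>\<^sup>+x. p1 x - m x \<partial>\<mu>) = 0"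
      unfolding \<Delta>_def[symmetric] \<Delta>1[symmetric] by auto
    then have "AE x in \<mu>. p0 x - m x = 0" "AE x in \<mu>. p1 x - m x = 0"
      by (simp_all add: nn_integral_0_iff_AE)
    then have "AE x in \<mu>. p0 x = p1 x"
      using fin0 fin1
    proof eventually_elim
      case (elim x)
      then have "p0 x \<le> m x" "p1 x \<le> m x" by (auto simp: diff_eq_0_iff_ennreal)
      then show ?case by (auto simp: m_def min_def split: if_splits)
    qed
    then have "density \<mu> p0 = density \<mu> p1" by (intro density_cong) auto
    with ne show False by simp
  qed
  define \<Lambda> where "\<Lambda> = density \<mu> (\<lambda>x. (p1 x - m x) / \<Delta>)"
  have emL: "\<Delta> * emeasure \<Lambda> B = (\<integral>\<^sup>+x. (p1 x - m x) * indicator B x \<partial>\<mu>)" if [measurable]: "B \<in> sets \<mu>" for B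
  proof -
    have "emeasure \<Lambda> B = (\<integral>\<^sup>+x. ((p1 x - m x) * indicator B x) / \<Delta> \<partial>\<mu>)"
      unfolding \<Lambda>_def by (subst emeasure_density) (auto simp: divide_ennreal_def ac_simps)
    also have "\<dots> = (\<integral>\<^sup>+x. (p1 x - m x) * indicator B x \<partial>\<mu>) / \<Delta>"
      by (rule nn_integral_divide) measurable
    finally show ?thesis using ennreal_mult_divide_cancel[OF \<Delta>ne \<Delta>fin] by simp
  qed
  have "emeasure \<Lambda> (space \<Lambda>) = 1"
  proof -
    have "\<Delta> * emeasure \<Lambda> (space \<mu>) = \<Delta>"
      using emL[of "space \<mu>"] \<Delta>1 by (simp cong: nn_integral_cong_simp)
    then have "emeasure \<Lambda> (space \<mu>) * \<Delta> / \<Delta> = 1 * \<Delta> / \<Delta>" by (simp add: mult.commute)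
    moreover have "k * \<Delta> / \<Delta> = k" for k
      using \<Delta>ne \<Delta>fin by (intro mult_divide_eq_ennreal) auto
    ultimately have "emeasure \<Lambda> (space \<mu>) = 1" by (simp only:)
    then show ?thesis by (simp add: \<Lambda>_def)
  qed
  then interpret L: prob_space \<Lambda> by (rule prob_spaceI)
  define U where "U = uniform_measure lborel {0..1::real}"
  interpret U: prob_space U unfolding U_def by (rule prob_space_uniform_measure) auto
  \<comment> \<open>The probability of keeping \<open>x\<close>, chosen so that
    \<open>p0 * r = m\<close> almost everywhere. Where \<open>p0 x = 0\<close> both sides vanish
    whatever the quotient is; the points with \<open>p0 x = \<infinity>\<close> form a null
    set.\<close>
  define r where "r x = enn2real (min 1 (p1 x / p0 x))" for x
  have [measurable]: "r \<in> borel_measurable \<mu>" unfolding r_def by measurable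
  have r01: "0 \<le> r x" "r x \<le> 1" for x
    unfolding r_def by (auto simp: enn2real_leI)
  have r_eq: "ennreal (r x) = min 1 (p1 x / p0 x)" for x
    unfolding r_def by (rule ennreal_enn2real) (simp add: min_less_iff_disj)
  have p0r: "AE x in \<mu>. p0 x * ennreal (r x) = m x"
    using fin0
  proof eventually_elim
    case (elim x)
    show ?case
    proof (cases "p0 x = 0")
      case False
      have "p0 x * min 1 (p1 x / p0 x) = min (p0 x * 1) (p0 x * (p1 x / p0 x))"
        by (rule min_of_mono[symmetric]) (simp add: mono_def mult_left_mono)
      then show ?thesis
        unfolding r_eq m_def ennreal_mult_divide_cancel[OF False elim] by simp
    qed (simp add: m_def)
  qed
  have p0r': "AE x in \<mu>. p0 x * ennreal (1 - r x) = p0 x - m x"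
    using p0r fin0
  proof eventually_elim
    case (elim x)
    have "p0 x * ennreal (1 - r x) = p0 x * (1 - ennreal (r x))"
      using r01[of x] by (simp add: ennreal_minus[symmetric])
    also have "\<dots> = p0 x * 1 - p0 x * ennreal (r x)"
      using elim by (intro ennreal_right_diff_distrib) auto
    finally show ?case using elim by simp
  qed
  \<comment> \<open>Given \<open>x\<close>, keep it with probability \<open>r x\<close>, decided by a uniform seed; otherwise redraw it from
    the normalised excess \<open>\<Lambda>\<close> of \<open>p1\<close> over \<open>min p0 p1\<close>.\<close>
  define Q where "Q = (P0 \<Otimes>\<^sub>M U) \<Otimes>\<^sub>M \<Lambda>"
  interpret PU: pair_prob_space P0 U ..
  interpret PUL: pair_prob_space "P0 \<Otimes>\<^sub>M U" \<Lambda> ..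
  interpret Q: prob_space Q unfolding Q_def by (rule PUL.prob_space_axioms)
  have s [measurable_cong, simp]: "sets P0 = sets \<mu>" "sets \<Lambda> = sets \<mu>" "sets U = sets borel"
    by (simp_all add: P0_def \<Lambda>_def U_def)
  have sp: "space P0 = space \<mu>" "space \<Lambda> = space \<mu>" "space U = UNIV"
    by (simp_all add: P0_def \<Lambda>_def U_def)
  define F where "F = {z \<in> space Q. r (fst (fst z)) < snd (fst z)}"
  define g where "g z = (if r (fst (fst z)) < snd (fst z) then snd z else fst (fst z))" for z :: "('a \<times> real) \<times> 'a"
  have F [measurable]: "F \<in> sets Q" unfolding F_def Q_def by measurable
  have fm: "fst \<circ> fst \<in> Q \<rightarrow>\<^sub>M \<mu>" unfolding Q_def comp_def by measurable
  have gm [measurable]: "g \<in> Q \<rightarrow>\<^sub>M \<mu>" unfolding Q_def g_def by measurable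
  have Q_int: "(\<integral>\<^sup>+z. h z \<partial>Q) = (\<integral>\<^sup>+x. p0 x * (\<integral>\<^sup>+v. (\<integral>\<^sup>+y. h ((x, v), y) \<partial>\<Lambda>) \<partial>U) \<partial>\<mu>)"
    if h: "h \<in> borel_measurable Q" for h :: "('a \<times> real) \<times> 'a \<Rightarrow> ennreal"
  proof -
    have h' [measurable]: "h \<in> borel_measurable ((P0 \<Otimes>\<^sub>M U) \<Otimes>\<^sub>M \<Lambda>)" using h unfolding Q_def .
    have "(\<integral>\<^sup>+z. h z \<partial>Q) = (\<integral>\<^sup>+w. (\<integral>\<^sup>+y. h (w, y) \<partial>\<Lambda>) \<partial>(P0 \<Otimes>\<^sub>M U))"
      unfolding Q_def by (rule L.nn_integral_fst[OF h', symmetric])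
    also have "\<dots> = (\<integral>\<^sup>+x. (\<integral>\<^sup>+v. (\<integral>\<^sup>+y. h ((x, v), y) \<partial>\<Lambda>) \<partial>U) \<partial>P0)"
      by (rule U.nn_integral_fst[symmetric]) measurable
    also have "\<dots> = (\<integral>\<^sup>+x. p0 x * (\<integral>\<^sup>+v. (\<integral>\<^sup>+y. h ((x, v), y) \<partial>\<Lambda>) \<partial>U) \<partial>\<mu>)"
    proof -
      have "(\<lambda>x. \<integral>\<^sup>+v. (\<integral>\<^sup>+y. h ((x, v), y) \<partial>\<Lambda>) \<partial>U) \<in> borel_measurable P0" by measurable
      then show ?thesis unfolding P0_def by (intro nn_integral_density) auto
    qed
    finally show ?thesis .
  qed
  have U_r: "emeasure U {..r x} = ennreal (r x)" "emeasure U {r x<..} = ennreal (1 - r x)" for x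
    unfolding U_def by (rule emeasure_uniform_unit[OF r01])+
  \<comment> \<open>The redraw probability is the mass of \<open>p0 * (1 - r)\<close>, that is, of
    the excess \<open>p0 - m\<close>.\<close>
  have QF: "emeasure Q F = \<Delta>"
  proof -
    have "emeasure Q F = (\<integral>\<^sup>+z. indicator F z \<partial>Q)" by simp
    also have "\<dots> = (\<integral>\<^sup>+x. p0 x * (\<integral>\<^sup>+v. (\<integral>\<^sup>+y. indicator F ((x, v), y) \<partial>\<Lambda>) \<partial>U) \<partial>\<mu>)"
      by (rule Q_int) measurable
    also have "\<dots> = (\<integral>\<^sup>+x. p0 x * ennreal (1 - r x) \<partial>\<mu>)"
    proof (rule nn_integral_cong)
      fix x assume x: "x \<in> space \<mu>"
      have "(\<integral>\<^sup>+v. (\<integral>\<^sup>+y. indicator F ((x, v), y) \<partial>\<Lambda>) \<partial>U) = (\<integral>\<^sup>+v. (\<integral>\<^sup>+y. indicator {r x<..} v \<partial>\<Lambda>) \<partial>U)"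
        using x by (intro nn_integral_cong) (auto simp: F_def Q_def space_pair_measure sp indicator_def)
      then show "p0 x * (\<integral>\<^sup>+v. (\<integral>\<^sup>+y. indicator F ((x, v), y) \<partial>\<Lambda>) \<partial>U) = p0 x * ennreal (1 - r x)"
        by (simp add: L.emeasure_space_1 U_r)
    qed
    also have "\<dots> = \<Delta>"
      unfolding \<Delta>_def by (rule nn_integral_cong_AE[OF p0r'])
    finally show ?thesis .
  qed

  \<comment> \<open>Marginals and total variation\<close>
  show thesis
  proof (rule that[of Q g F])
    show "prob_space Q" "fst \<circ> fst \<in> Q \<rightarrow>\<^sub>M \<mu>" "g \<in> Q \<rightarrow>\<^sub>M \<mu>" "F \<in> sets Q"
      by (fact Q.prob_space_axioms fm gm F)+
    show "(fst \<circ> fst) z = g z" if "z \<in> space Q" "z \<notin> F" for z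
      using that by (auto simp: F_def g_def)
    show "distr Q \<mu> (fst \<circ> fst) = density \<mu> p0"
    proof (rule measure_eqI)
      fix B assume "B \<in> sets (distr Q \<mu> (fst \<circ> fst))"
      then have [measurable]: "B \<in> sets \<mu>" by simp
      have "emeasure (distr Q \<mu> (fst \<circ> fst)) B = (\<integral>\<^sup>+z. indicator B (fst (fst z)) \<partial>Q)"
        using fm by (simp add: nn_integral_indicator[symmetric] nn_integral_distr comp_def del: nn_integral_indicator)
      also have "\<dots> = (\<integral>\<^sup>+x. p0 x * indicator B x \<partial>\<mu>)"
        by (subst Q_int) (auto simp: Q_def L.emeasure_space_1 U.emeasure_space_1)
      finally show "emeasure (distr Q \<mu> (fst \<circ> fst)) B = emeasure (density \<mu> p0) B"
        by (simp add: emeasure_density)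
    qed simp
    \<comment> \<open>Kept points contribute the density \<open>m\<close>. Redrawn points contribute
      \<open>\<Delta>\<close> times \<open>\<Lambda>\<close>, which has density
      \<open>p1 - m\<close>.\<close>
    show "distr Q \<mu> g = density \<mu> p1"
    proof (rule measure_eqI)
      fix B assume "B \<in> sets (distr Q \<mu> g)"
      then have B [measurable]: "B \<in> sets \<mu>" by simp
      have "emeasure (distr Q \<mu> g) B = (\<integral>\<^sup>+z. indicator B (g z) \<partial>Q)"
        by (simp add: nn_integral_indicator[symmetric] nn_integral_distr del: nn_integral_indicator)
      also have "\<dots> = (\<integral>\<^sup>+x. p0 x * (\<integral>\<^sup>+v. (\<integral>\<^sup>+y. indicator B (g ((x, v), y)) \<partial>\<Lambda>) \<partial>U) \<partial>\<mu>)"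
        by (rule Q_int) measurable
      also have "\<dots> = (\<integral>\<^sup>+x. p0 x * (ennreal (r x) * indicator B x + ennreal (1 - r x) * emeasure \<Lambda> B) \<partial>\<mu>)"
      proof (rule nn_integral_cong)
        fix x
        have "(\<integral>\<^sup>+y. indicator B (g ((x, v), y)) \<partial>\<Lambda>)
            = indicator {..r x} v * indicator B x + indicator {r x<..} v * emeasure \<Lambda> B" for v
          by (cases "r x < v") (auto simp: g_def L.emeasure_space_1)
        then show "p0 x * (\<integral>\<^sup>+v. (\<integral>\<^sup>+y. indicator B (g ((x, v), y)) \<partial>\<Lambda>) \<partial>U)
            = p0 x * (ennreal (r x) * indicator B x + ennreal (1 - r x) * emeasure \<Lambda> B)"
          by (simp add: nn_integral_add nn_integral_multc U_r)
      qed
      also have "\<dots> = (\<integral>\<^sup>+x. m x * indicator B x + (p0 x - m x) * emeasure \<Lambda> B \<partial>\<mu>)"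
        using p0r p0r' by (intro nn_integral_cong_AE) (auto simp: distrib_left mult.assoc[symmetric])
      also have "\<dots> = (\<integral>\<^sup>+x. m x * indicator B x \<partial>\<mu>) + \<Delta> * emeasure \<Lambda> B"
        unfolding \<Delta>_def by (simp add: nn_integral_add nn_integral_multc)
      also have "\<dots> = (\<integral>\<^sup>+x. m x * indicator B x + (p1 x - m x) * indicator B x \<partial>\<mu>)"
        by (simp add: emL nn_integral_add)
      also have "\<dots> = (\<integral>\<^sup>+x. p1 x * indicator B x \<partial>\<mu>)"
        by (intro nn_integral_cong) (auto simp: m_def indicator_def)
      finally show "emeasure (distr Q \<mu> g) B = emeasure (density \<mu> p1) B"
        by (simp add: emeasure_density)
    qed simp
    \<comment> \<open>On this set the first law exceeds the second by exactly
      \<open>\<Delta>\<close>, the probability of \<open>F\<close>, and any such difference is at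
      most the supremum in \<open>TV\<close>.\<close>
    define A where "A = {x \<in> space \<mu>. p1 x < p0 x}"
    have A [measurable]: "A \<in> sets \<mu>" unfolding A_def by measurable
    have "emeasure P0 A = (\<integral>\<^sup>+x. (p0 x - m x) + p1 x * indicator A x \<partial>\<mu>)"
    proof -
      have "emeasure P0 A = (\<integral>\<^sup>+x. p0 x * indicator A x \<partial>\<mu>)"
        unfolding P0_def by (rule emeasure_density) measurable
      also have "\<dots> = (\<integral>\<^sup>+x. (p0 x - m x) + p1 x * indicator A x \<partial>\<mu>)"
      proof (intro nn_integral_cong_AE AE_mp[OF fin0 AE_I2] impI)
        fix x assume x: "x \<in> space \<mu>" "p0 x \<noteq> \<infinity>"
        show "p0 x * indicator A x = (p0 x - m x) + p1 x * indicator A x"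
        proof (cases "p1 x < p0 x")
          case True
          then show ?thesis using x by (auto simp: A_def m_def min_def diff_add_cancel_ennreal not_le)
        next
          case False
          then show ?thesis using x
            by (simp add: A_def m_def min_def diff_eq_0_iff_ennreal less_top[symmetric] not_less)
        qed
      qed
      finally show ?thesis .
    qed
    also have "\<dots> = \<Delta> + emeasure P1 A"
      unfolding \<Delta>_def P1_def by (simp add: nn_integral_add emeasure_density)
    also have "\<dots> = ennreal (measure Q F + measure P1 A)"
      by (simp add: QF[symmetric] Q.emeasure_eq_measure P1.emeasure_eq_measure)
    finally have "measure P0 A = measure Q F + measure P1 A"
      by (simp add: P0.emeasure_eq_measure del: ennreal_plus)
    moreover have "measure P0 A - measure P1 A \<le> TV P0 P1"
      by (rule measure_diff_le_TV) (simp_all add: P0.prob_space_axioms P1.prob_space_axioms)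
    ultimately show "measure Q F \<le> TV (density \<mu> p0) (density \<mu> p1)"
      by (simp add: P0_def P1_def)
  qed
qed

context seq_test begin

text \<open>The entries of \<open>x\<close> in \<open>D\<close> are replaced by those of
  \<open>x'\<close> one at a time; consecutive sequences are neighboring, so each replacement costs
  a factor \<open>exp \<epsilon>\<close>. \<open>D\<close> only has to contain the indices of
  difference, so a set of flagged indices may be used.\<close>

lemma group_privacy:
  assumes dp: "differentially_private \<epsilon> M R \<tau> d" and D: "finite D"
    and x: "x \<in> space (seq_space M)" and x': "x' \<in> space (seq_space M)"
    and eq: "\<And>i. i \<notin> D \<Longrightarrow> x i = x' i"
  shows "stop_prob t b x \<le> ennreal (exp (\<epsilon> * card D)) * stop_prob t b x'"
  using D x eq
proof (induction D arbitrary: x rule: finite_induct)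
  case empty
  then have "x = x'" by auto
  then show ?case by simp
next
  case (insert j D)
  let ?y = "x(j := x' j)"
  have y: "?y \<in> space (seq_space M)"
    using insert.prems(1) x' by (auto simp: space_PiM PiE_iff)
  have "neighboring x ?y" by (auto simp: neighboring_def)
  then have "measure R {u \<in> space R. \<tau> (x, u) = enat t \<and> d (x, u) = b}
      \<le> exp \<epsilon> * measure R {u \<in> space R. \<tau> (?y, u) = enat t \<and> d (?y, u) = b}"
    using dp insert.prems(1) y unfolding differentially_private_def by blast
  then have "stop_prob t b x \<le> ennreal (exp \<epsilon>) * stop_prob t b ?y"
    unfolding stop_prob_def R.emeasure_eq_measure by (simp add: ennreal_mult[symmetric] ennreal_leI)
  also have "\<dots> \<le> ennreal (exp \<epsilon>) * (ennreal (exp (\<epsilon> * card D)) * stop_prob t b x')"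
    using insert.prems(2) by (intro mult_left_mono insert.IH y) auto
  also have "\<dots> = ennreal (exp (\<epsilon> * card (insert j D))) * stop_prob t b x'"
    using insert.hyps by (simp add: mult.assoc[symmetric] ennreal_mult[symmetric] exp_add[symmetric] algebra_simps)
  finally show ?case .
qed

text \<open>Before time \<open>t\<close> the paths \<open>f \<circ> z\<close> and
  \<open>g \<circ> z\<close> differ only at indices whose sample lies in \<open>F\<close>. The sum
  of the increments is \<open>\<epsilon>\<close> times the number of these indices, so its weight
  cancels the group privacy factor for every \<open>z\<close>.\<close>

lemma privacy_coupling_bound:
  fixes Q :: "'z measure"
  assumes dp: "differentially_private \<epsilon> M R \<tau> d"
    and Q: "prob_space Q" and f: "f \<in> Q \<rightarrow>\<^sub>M M" and g: "g \<in> Q \<rightarrow>\<^sub>M M" and F: "F \<in> sets Q"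
    and fg: "\<And>z. z \<in> space Q \<Longrightarrow> z \<notin> F \<Longrightarrow> f z = g z"
    and \<alpha>: "0 < \<alpha>" "\<alpha> < 1" and \<beta>: "0 < \<beta>" "\<beta> < 1" and \<alpha>\<beta>: "\<alpha> + \<beta> \<le> 1"
    and err0: "prob_decide (joint_law (distr Q M f) R) \<tau> d (\<not> c) \<le> \<alpha>"
    and err1: "prob_decide (joint_law (distr Q M g) R) \<tau> d c \<le> \<beta>"
    and fin: "expected_time (joint_law (distr Q M f) R) \<tau> \<noteq> \<infinity>"
  shows "kl \<alpha> (1 - \<beta>) \<le> enn2real (expected_time (joint_law (distr Q M f) R) \<tau>) * (\<epsilon> * measure Q F)"
proof -
  interpret Q: prob_space Q by fact
  define \<l> where "\<l> z = \<epsilon> * indicator F z" for z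
  have int: "integrable Q \<l>" and l_int: "(\<integral>z. \<l> z \<partial>Q) = \<epsilon> * measure Q F"
    unfolding \<l>_def using F by (simp_all add: Q.emeasure_eq_measure)
  have change: "(\<integral>\<^sup>+z. ennreal (exp (- (\<Sum>i<t. \<l> (z i)))) * stop_prob t b (f \<circ> z) \<partial>seq_space Q)
      \<le> (\<integral>\<^sup>+x. stop_prob t b x \<partial>seq_space (distr Q M g))" for t b
  proof -
    have "(\<integral>\<^sup>+z. ennreal (exp (- (\<Sum>i<t. \<l> (z i)))) * stop_prob t b (f \<circ> z) \<partial>seq_space Q)
        \<le> (\<integral>\<^sup>+z. stop_prob t b (g \<circ> z) \<partial>seq_space Q)"
    proof (rule nn_integral_mono)
      fix z assume "z \<in> space (seq_space Q)"
      then have z: "z i \<in> space Q" for i by (auto simp: space_PiM PiE_iff)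
      define D where "D = {i. i < t \<and> z i \<in> F}"
      have D: "finite D" by (simp add: D_def)
      \<comment> \<open>Group privacy allows finitely many changes, but the two paths may differ
        infinitely often. The hybrid \<open>y\<close> follows \<open>g\<close> before
        \<open>t\<close> and \<open>f\<close> afterwards; stopping at \<open>t\<close> cannot tell
        it from \<open>g \<circ> z\<close>.\<close>
      define y where "y i = (if i < t then g (z i) else f (z i))" for i
      have sp: "f \<circ> z \<in> space (seq_space M)" "g \<circ> z \<in> space (seq_space M)" "y \<in> space (seq_space M)"
        using measurable_space[OF f z] measurable_space[OF g z] by (auto simp: space_PiM PiE_iff y_def)
      have "(\<Sum>i<t. \<l> (z i)) = (\<Sum>i<t. if z i \<in> F then \<epsilon> else 0)"
        by (intro sum.cong) (auto simp: \<l>_def)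
      also have "\<dots> = (\<Sum>i\<in>D. \<epsilon>)"
        by (simp add: sum.inter_filter[symmetric] D_def)
      also have "\<dots> = \<epsilon> * card D" by simp
      finally have S: "(\<Sum>i<t. \<l> (z i)) = \<epsilon> * card D" .
      have "stop_prob t b (f \<circ> z) \<le> ennreal (exp (\<epsilon> * card D)) * stop_prob t b y"
        using fg[OF z] by (intro group_privacy[OF dp D sp(1,3)]) (auto simp: y_def D_def)
      also have "stop_prob t b y = stop_prob t b (g \<circ> z)"
        by (rule stop_prob_cong[OF sp(3,2)]) (simp add: y_def)
      finally have "ennreal (exp (- (\<epsilon> * card D))) * stop_prob t b (f \<circ> z)
          \<le> ennreal (exp (- (\<epsilon> * card D))) * (ennreal (exp (\<epsilon> * card D)) * stop_prob t b (g \<circ> z))"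
        by (rule mult_left_mono) simp
      also have "\<dots> = stop_prob t b (g \<circ> z)"
        by (simp add: mult.assoc[symmetric] ennreal_mult[symmetric] exp_add[symmetric])
      finally show "ennreal (exp (- (\<Sum>i<t. \<l> (z i)))) * stop_prob t b (f \<circ> z) \<le> stop_prob t b (g \<circ> z)"
        unfolding S .
    qed
    also have "\<dots> = (\<integral>\<^sup>+x. stop_prob t b x \<partial>seq_space (distr Q M g))"
      unfolding distr_seq_space[OF Q g, symmetric]
      by (subst nn_integral_distr[OF measurable_comp_seq_space[OF g]])
        (simp_all only: measurable_distr_eq1 measurable_stop_prob)
    finally show ?thesis .
  qed
  show ?thesis
    unfolding l_int[symmetric]
    by (rule change_of_measure_bound[OF Q f int Q.prob_space_distr[OF g] sets_distr change \<alpha> \<beta> \<alpha>\<beta> err0 err1 fin])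
qed

end

text \<open>Treats the extended values: an infinite expected time \<open>e\<close> satisfies any
  bound, and an infinite divergence \<open>a\<close> drops out of the minimum because
  \<open>b\<close> is finite.\<close>

lemma ennreal_divide_min_le:
  fixes k a b e :: ennreal
  assumes "b \<noteq> \<infinity>" and "e \<noteq> \<infinity> \<Longrightarrow> a \<noteq> \<infinity> \<Longrightarrow> k \<le> e * a" and "e \<noteq> \<infinity> \<Longrightarrow> k \<le> e * b"
  shows "k / min a b \<le> e"
proof (cases "e = \<infinity>")
  case False
  define m where "m = min a b"
  have "m \<le> b" by (simp add: m_def)
  then have "m < \<infinity>" using assms(1) by (simp add: less_top le_less_trans)
  moreover have "m = a \<or> m = b" by (auto simp: m_def min_def)
  ultimately have m: "m \<noteq> \<infinity>" "k \<le> e * m"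
    using assms(2,3)[OF False] by auto
  show ?thesis
  proof (cases "m = 0")
    \<comment> \<open>Here \<open>k \<le> e * 0\<close> forces \<open>k = 0\<close>, and
      \<open>0 / 0 = 0\<close> in \<open>ennreal\<close>.\<close>
    case True
    then show ?thesis using m by (simp add: m_def)
  next
    case False
    have "k / m \<le> e * m / m"
      using m by (intro divide_right_mono_ennreal) auto
    also have "\<dots> = e"
      using False m by (intro mult_divide_eq_ennreal) auto
    finally show ?thesis by (simp add: m_def)
  qed
qed simp

text \<open>One of the two inequalities, with \<open>c\<close> the correct decision under
  \<open>p0\<close>; exchanging laws, error bounds and decisions gives the other.\<close>

lemma private_test_time_bound:
  fixes \<mu> :: "'a measure" and R :: "'r measure" and p0 p1 :: "'a \<Rightarrow> ennreal"
  assumes p0: "p0 \<in> borel_measurable \<mu>" and P0: "prob_space (density \<mu> p0)"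
    and p1: "p1 \<in> borel_measurable \<mu>" and P1: "prob_space (density \<mu> p1)"
    and ne: "density \<mu> p0 \<noteq> density \<mu> p1"
    and \<alpha>: "0 < \<alpha>" "\<alpha> < 1" and \<beta>: "0 < \<beta>" "\<beta> < 1" and \<alpha>\<beta>: "\<alpha> + \<beta> \<le> 1" and \<epsilon>: "0 < \<epsilon>"
    and test: "sequential_test \<mu> R \<tau> d" and dp: "differentially_private \<epsilon> \<mu> R \<tau> d"
    and err0: "prob_decide (joint_law (density \<mu> p0) R) \<tau> d (\<not> c) \<le> \<alpha>"
    and err1: "prob_decide (joint_law (density \<mu> p1) R) \<tau> d c \<le> \<beta>"
  shows "ennreal (kl \<alpha> (1 - \<beta>)) / min (KL (density \<mu> p0) (density \<mu> p1))
        (ennreal (\<epsilon> * TV (density \<mu> p0) (density \<mu> p1)))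
      \<le> expected_time (joint_law (density \<mu> p0) R) \<tau>"
proof (rule ennreal_divide_min_le)
  interpret seq_test \<mu> R \<tau> d by (rule seq_test.intro[OF test])
  let ?e = "expected_time (joint_law (density \<mu> p0) R) \<tau>"
  show "ennreal (\<epsilon> * TV (density \<mu> p0) (density \<mu> p1)) \<noteq> \<infinity>" by simp
  assume fin: "?e \<noteq> \<infinity>"
  show "ennreal (kl \<alpha> (1 - \<beta>)) \<le> ?e * KL (density \<mu> p0) (density \<mu> p1)"
    if "KL (density \<mu> p0) (density \<mu> p1) \<noteq> \<infinity>"
    by (rule KL_bound[OF P0 sets_density P1 sets_density \<alpha> \<beta> \<alpha>\<beta> err0 err1 fin that])
  obtain Q :: "(('a \<times> real) \<times> 'a) measure" and g F
    where Q: "prob_space Q" "fst \<circ> fst \<in> Q \<rightarrow>\<^sub>M \<mu>" "g \<in> Q \<rightarrow>\<^sub>M \<mu>" "F \<in> sets Q"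
      and distr: "distr Q \<mu> (fst \<circ> fst) = density \<mu> p0" "distr Q \<mu> g = density \<mu> p1"
      and fg: "\<And>z. z \<in> space Q \<Longrightarrow> z \<notin> F \<Longrightarrow> (fst \<circ> fst) z = g z"
      and F: "measure Q F \<le> TV (density \<mu> p0) (density \<mu> p1)"
    by (rule maximal_coupling[OF p0 p1 P0 P1 ne]) blast
  have "kl \<alpha> (1 - \<beta>) \<le> enn2real (expected_time (joint_law (distr Q \<mu> (fst \<circ> fst)) R) \<tau>) * (\<epsilon> * measure Q F)"
    by (rule privacy_coupling_bound[OF dp Q _ \<alpha> \<beta> \<alpha>\<beta>, where c = c]; (unfold distr)?; fact)
  then have "kl \<alpha> (1 - \<beta>) \<le> enn2real ?e * (\<epsilon> * measure Q F)"
    unfolding distr .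
  also have "\<dots> \<le> enn2real ?e * (\<epsilon> * TV (density \<mu> p0) (density \<mu> p1))"
    using F \<epsilon> by (intro mult_left_mono) auto
  finally have "ennreal (kl \<alpha> (1 - \<beta>)) \<le> ennreal (enn2real ?e * (\<epsilon> * TV (density \<mu> p0) (density \<mu> p1)))"
    by (rule ennreal_leI)
  also have "\<dots> = ?e * ennreal (\<epsilon> * TV (density \<mu> p0) (density \<mu> p1))"
    using fin by (simp add: ennreal_mult' less_top[symmetric])
  finally show "ennreal (kl \<alpha> (1 - \<beta>)) \<le> ?e * ennreal (\<epsilon> * TV (density \<mu> p0) (density \<mu> p1))" .
qed

text \<open>If \<open>\<alpha> + \<beta>\<close> exceeded 1, a test stopping at time 0 and deciding
  by a suitable coin could meet both error bounds although \<open>kl \<alpha> (1 - \<beta>)\<close>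
  is positive.\<close>

theorem theorem5:
  fixes \<mu> :: "'a measure" and R :: "'r measure"
    and \<nu> :: "'p \<Rightarrow> 'a measure" and p :: "'p \<Rightarrow> 'a \<Rightarrow> ennreal" and \<theta>0 \<theta>1 :: 'p
    and \<tau> :: "(nat \<Rightarrow> 'a) \<times> 'r \<Rightarrow> enat" and d :: "(nat \<Rightarrow> 'a) \<times> 'r \<Rightarrow> bool"
    and \<alpha> \<beta> \<epsilon> :: real
  assumes "p \<theta>0 \<in> borel_measurable \<mu>" and "\<nu> \<theta>0 = density \<mu> (p \<theta>0)" and "prob_space (\<nu> \<theta>0)"
    and "p \<theta>1 \<in> borel_measurable \<mu>" and "\<nu> \<theta>1 = density \<mu> (p \<theta>1)" and "prob_space (\<nu> \<theta>1)"
    and "\<nu> \<theta>0 \<noteq> \<nu> \<theta>1"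
    and "0 < \<alpha>" and "\<alpha> < 1" and "0 < \<beta>" and "\<beta> < 1" and "\<alpha> + \<beta> \<le> 1"
    and "0 < \<epsilon>"
    and "sequential_test \<mu> R \<tau> d"
    and "differentially_private \<epsilon> \<mu> R \<tau> d"
    and "prob_decide (joint_law (\<nu> \<theta>0) R) \<tau> d True \<le> \<alpha>"
    and "prob_decide (joint_law (\<nu> \<theta>1) R) \<tau> d False \<le> \<beta>"
  shows "expected_time (joint_law (\<nu> \<theta>0) R) \<tau>
           \<ge> ennreal (kl \<alpha> (1 - \<beta>)) / min (KL (\<nu> \<theta>0) (\<nu> \<theta>1)) (ennreal (\<epsilon> * TV (\<nu> \<theta>0) (\<nu> \<theta>1)))
       \<and> expected_time (joint_law (\<nu> \<theta>1) R) \<tau>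
           \<ge> ennreal (kl \<beta> (1 - \<alpha>)) / min (KL (\<nu> \<theta>1) (\<nu> \<theta>0)) (ennreal (\<epsilon> * TV (\<nu> \<theta>0) (\<nu> \<theta>1)))"
proof -
  note P = assms(3,6,7)[unfolded assms(2,5)]
  note err = assms(16,17)[unfolded assms(2,5)]
  have TV: "TV (density \<mu> (p \<theta>0)) (density \<mu> (p \<theta>1)) = TV (density \<mu> (p \<theta>1)) (density \<mu> (p \<theta>0))"
    by (rule TV_commute) simp
  have \<beta>\<alpha>: "\<beta> + \<alpha> \<le> 1" using assms(12) by simp
  show ?thesis
    unfolding assms(2,5)
  proof
    show "ennreal (kl \<alpha> (1 - \<beta>)) / min (KL (density \<mu> (p \<theta>0)) (density \<mu> (p \<theta>1)))
        (ennreal (\<epsilon> * TV (density \<mu> (p \<theta>0)) (density \<mu> (p \<theta>1))))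
      \<le> expected_time (joint_law (density \<mu> (p \<theta>0)) R) \<tau>"
      by (rule private_test_time_bound[where c = False, OF assms(1) P(1) assms(4) P(2,3) assms(8-15)])
        (simp_all only: err not_False_eq_True)
    show "ennreal (kl \<beta> (1 - \<alpha>)) / min (KL (density \<mu> (p \<theta>1)) (density \<mu> (p \<theta>0)))
        (ennreal (\<epsilon> * TV (density \<mu> (p \<theta>0)) (density \<mu> (p \<theta>1))))
      \<le> expected_time (joint_law (density \<mu> (p \<theta>1)) R) \<tau>"
      \<comment> \<open>Symmetry of the distance matches the denominators; \<open>True\<close> is
        the correct decision under the second law.\<close>
      unfolding TV
      by (rule private_test_time_bound[where c = True, OF assms(4) P(2) assms(1) P(1) P(3)[symmetric]
            assms(10,11,8,9) \<beta>\<alpha> assms(13-15)])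
        (simp_all only: err not_True_eq_False)
  qed
qed

end
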